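(* Let $d\in\mathbb{N}$, let $\mathcal{Z}$ be a bounded subset of $M_d(\mathbb{R})\times M_d(\mathbb{R})$, and let $\tau\ge 0$. Assume that $\lambda(\Sigma_{\mathcal{Z},\tau})<+\infty$. Then: 1. $\Sigma_{\mathcal{Z},\tau}$ is exponentially stable (ES) if and only if $\lambda(\Sigma_{\mathcal{Z},\tau})<0$; 2. $\Sigma_{\mathcal{Z},\tau}$ is exponentially unstable (EU) if and only if $\lambda(\Sigma_{\mathcal{Z},\tau})>0$.
   Context: $\mathbb{N}$ is the set of positive integers. $M_d(\mathbb{R})$ is the set of $d\times d$ real matrices, $|\cdot|$ the Euclidean norm on $\mathbb{R}^d$, $\|\cdot\|$ the induced operator norm. Conventions: $\log 0=-\infty$, $\sup\emptyset=-\infty$. Switching signals. $\mathcal{S}_{\mathcal{Z}}$ is the set of right-continuous piecewise-constant functions $Z=(Z_1(\cdot),Z_2(\cdot)):[0,+\infty)\to\mathcal{Z}$, each given together with a strictly increasing sequence of switching times $(t_k)_{k\in\Theta^\star(Z)}$ in $(0,+\infty)$ having no finite accumulation point, where $\Theta^\star(Z)$ is $\emptyset$, $\{1,\dots,N\}$ for some $N\in\mathbb{N}$, or $\mathbb{N}$ (no, $N$, or infinitely many switchings). Set $t_0=0$ and, if $\Theta^\star(Z)$ is finite with cardinality $N$, $t_{N+1}=+\infty$. Let $\Theta(Z)=\{0\}\cup\Theta^\star(Z)$. The function $Z$ is constant on $[t_k,t_{k+1})$ for every $k\in\Theta(Z)$; it is allowed that $Z$ takes the same value on two consecutive intervals.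 For $\tau\ge0$, $\mathcal{S}_{\mathcal{Z},\tau}\subset \mathcal{S}_{\mathcal{Z}}$ is the set of signals with $t_{k+1}\ge t_k+\tau$ for all $k\in\Theta(Z)$ (so $\mathcal{S}_{\mathcal{Z},0}=\mathcal{S}_{\mathcal{Z}}$). Impulsive switched system. $\Sigma_{\mathcal{Z},\tau}$ is the system in $\mathbb{R}^d$ $$\dot x(t)=Z_1(t_k)x(t),\ t\in[t_k,t_{k+1}),\ k\in\Theta(Z);\qquad x(t_k)=Z_2(t_{k-1})\lim_{t\nearrow t_k}x(t),\ k\in\Theta^\star(Z),$$ for $Z\in\mathcal{S}_{\mathcal{Z},\tau}$. $\Phi_Z(t,0)$ is the matrix mapping $x(0)$ to $x(t)$ for the solution associated with $Z$. The maximal Lyapunov exponent is $$\lambda(\Sigma_{\mathcal{Z},\tau})=\limsup_{t\to+\infty}\frac1t\sup_{Z\in\mathcal{S}_{\mathcal{Z},\tau}}\log(\|\Phi_Z(t,0)\|).$$ ES: there exist $c,\delta>0$ such that $\|\Phi_Z(t,0)\|\le ce^{-\delta t}$ for all $t\ge0$ and all $Z\in\mathcal{S}_{\mathcal{Z},\tau}$. EU: there exist $c,\delta>0$, $Z\in\mathcal{S}_{\mathcal{Z},\tau}$ and $x_0\in\mathbb{R}^d\setminus\{0\}$ such that $|\Phi_Z(t,0)x_0|\ge ce^{\delta t}|x_0|$ for all $t\ge0$. *)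

theory Defs
  imports "HOL-Analysis.Analysis"
begin

type_synonym 'n mode = "(real^'n^'n) \<times> (real^'n^'n)"

text \<open>
  A switching signal is a function of time together with its switching times. The field
  \<open>nsw\<close> is the number of switchings (possibly infinite), and \<open>swt k\<close> is the \<open>k\<close>-th switching
  time for \<open>1 \<le> k \<le> nsw\<close>. The values of \<open>swt\<close> at other indices and of \<open>val\<close> at negative
  times carry no information.
\<close>

record ('n::finite) signal =
  val :: "real \<Rightarrow> 'n mode"
  nsw :: enat
  swt :: "nat \<Rightarrow> real"

definition Theta_star :: "('n::finite) signal \<Rightarrow> nat set" where
  "Theta_star Z = {k. 1 \<le> k \<and> enat k \<le> nsw Z}"

definition Theta :: "('n::finite) signal \<Rightarrow> nat set" where
  "Theta Z = {0} \<union> Theta_star Z"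

text \<open>The switching times with the conventions \<open>t\<^sub>0 = 0\<close> and, for \<open>N < \<infinity>\<close> switchings,
  \<open>t\<^sub>N\<^sub>+\<^sub>1 = \<infinity>\<close>.\<close>

definition switch_time :: "('n::finite) signal \<Rightarrow> nat \<Rightarrow> ereal" where
  "switch_time Z k =
     (if k = 0 then 0 else if k \<in> Theta_star Z then ereal (swt Z k) else \<infinity>)"

definition mode_interval :: "('n::finite) signal \<Rightarrow> nat \<Rightarrow> real set" where
  "mode_interval Z k = {t. switch_time Z k \<le> ereal t \<and> ereal t < switch_time Z (Suc k)}"

text \<open>The value of the signal on the \<open>k\<close>-th interval, i.e. at time \<open>t\<^sub>k\<close>.\<close>

definition mode_at :: "('n::finite) signal \<Rightarrow> nat \<Rightarrow> 'n mode" where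
  "mode_at Z k = val Z (real_of_ereal (switch_time Z k))"

text \<open>Right-continuity of the signal is part of its constancy on the intervals
  \<open>[t\<^sub>k, t\<^sub>k\<^sub>+\<^sub>1)\<close>.\<close>

definition signals :: "('n::finite) mode set \<Rightarrow> 'n signal set" where
  "signals \<Z> = {Z.
     (\<forall>t\<ge>0. val Z t \<in> \<Z>) \<and>
     (\<forall>k\<in>Theta Z. switch_time Z k < switch_time Z (Suc k)) \<and>
     (\<forall>a. \<not> a islimpt (swt Z ` Theta_star Z)) \<and>
     (\<forall>k\<in>Theta Z. val Z constant_on mode_interval Z k)}"

definition dwell_signals :: "('n::finite) mode set \<Rightarrow> real \<Rightarrow> 'n signal set" where
  "dwell_signals \<Z> \<tau> = {Z \<in> signals \<Z>.
     \<forall>k\<in>Theta Z. switch_time Z (Suc k) \<ge> switch_time Z k + ereal \<tau>}"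

text \<open>The derivative is taken within \<open>[t\<^sub>k, t\<^sub>k\<^sub>+\<^sub>1)\<close>, hence it is the right derivative at
  \<open>t\<^sub>k\<close>. The matrix applied at the jump time \<open>t\<^sub>k\<close> is the second component of the mode that
  was active before the jump.\<close>

definition is_solution :: "('n::finite) signal \<Rightarrow> (real \<Rightarrow> real^'n) \<Rightarrow> bool" where
  "is_solution Z x \<longleftrightarrow>
     (\<forall>k\<in>Theta Z. \<forall>t\<in>mode_interval Z k.
        (x has_vector_derivative (fst (mode_at Z k) *v x t)) (at t within mode_interval Z k)) \<and>
     (\<forall>k\<in>Theta_star Z. \<exists>l. (x \<longlongrightarrow> l) (at_left (swt Z k)) \<and>
        x (swt Z k) = snd (mode_at Z (k - 1)) *v l)"

text \<open>The flow \<open>\<Phi>\<^sub>Z(t, 0)\<close>. For \<open>t \<ge> 0\<close> it is well defined, since each initial value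
  \<open>x(0)\<close> determines exactly one solution on \<open>[0, \<infinity>)\<close>.\<close>

definition flow_matrix :: "('n::finite) signal \<Rightarrow> real \<Rightarrow> real^'n^'n" where
  "flow_matrix Z t = (THE M. \<forall>x. is_solution Z x \<longrightarrow> x t = M *v x 0)"

definition op_norm :: "real^'n^'n \<Rightarrow> real" where
  "op_norm M = onorm (\<lambda>x. M *v x)"

definition log_ext :: "real \<Rightarrow> ereal" where
  "log_ext r = (if r = 0 then -\<infinity> else ereal (ln r))"

definition max_lyapunov :: "('n::finite) mode set \<Rightarrow> real \<Rightarrow> ereal" where
  "max_lyapunov \<Z> \<tau> =
     Limsup at_top (\<lambda>t::real. ereal (1 / t) *
       (SUP Z\<in>dwell_signals \<Z> \<tau>. log_ext (op_norm (flow_matrix Z t))))"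

definition exp_stable :: "('n::finite) mode set \<Rightarrow> real \<Rightarrow> bool" where
  "exp_stable \<Z> \<tau> \<longleftrightarrow>
     (\<exists>c>0. \<exists>\<delta>>0. \<forall>t\<ge>0. \<forall>Z\<in>dwell_signals \<Z> \<tau>.
        op_norm (flow_matrix Z t) \<le> c * exp (- \<delta> * t))"

definition exp_unstable :: "('n::finite) mode set \<Rightarrow> real \<Rightarrow> bool" where
  "exp_unstable \<Z> \<tau> \<longleftrightarrow>
     (\<exists>c>0. \<exists>\<delta>>0. \<exists>Z\<in>dwell_signals \<Z> \<tau>. \<exists>x\<^sub>0. x\<^sub>0 \<noteq> 0 \<and>
        (\<forall>t\<ge>0. norm (flow_matrix Z t *v x\<^sub>0) \<ge> c * exp (\<delta> * t) * norm x\<^sub>0))"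

end

theory Submission
  imports Defs "HOL-Computational_Algebra.Fundamental_Theorem_Algebra"
begin

text \<open>
  At every time the flow of a signal is a product \<open>e\<^bsup>s A\<^esup> P\<close>: \<open>P\<close> is a product of completed steps, each of the
  form \<open>R e\<^bsup>r B\<^esup>\<close> for a mode \<open>(B, R)\<close> that is active for a time \<open>r\<close> and then jumps, and \<open>A\<close> is the matrix
  of the running mode. So the theorem is about the growth of words of steps. Signals enter only through
  \<open>flow_matrix_factorization\<close>, which reads a word off a signal, and through \<open>signal_of_steps\<close> and
  \<open>constant_signal\<close>, which build signals.

  Stability. An exponent below a real number \<open>a\<close> says that the flows are below \<open>e\<^bsup>a t\<^esup>\<close> for large \<open>t\<close>. Smaller
  times follow, up to a constant, because the last mode may run on without a further switching and its flow
  can be undone at a bounded cost (\<open>word_bound_of_max_lyapunov_less\<close>). This gives the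
  criterion for exponential stability, and a uniform bound on short words whenever the exponent is finite.

  Instability. A growing trajectory forces a positive exponent. For the converse let \<open>0 < a < \<lambda>\<close>. If some mode
  matrix has an eigenvalue with real part above \<open>a / 4\<close>, the constant signal of that mode has a growing
  trajectory (\<open>exp_unstable_of_eigenvalue\<close>). Otherwise \<open>e\<^bsup>s A\<^esup>\<close> is at most \<open>K e\<^bsup>a s / 2\<^esup>\<close> with the same \<open>K\<close> for all
  modes (\<open>uniform_mexp_growth\<close>), so the growth at rate \<open>a\<close> must come from the completed words. The two cases
  have to be separated because a jump may be singular: growth inside a mode can be lost at the next
  switching, whereas growth of words can be continued by further words.

  In the second case the words are cut into chunks of duration at least one that satisfy the bound
  \<open>K' e\<^bsup>a r / 2\<^esup>\<close>. For a rate \<open>b\<close> the vectors whose orbits grow at rate at most \<open>b\<close> form an invariant subspace, and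
  since its dimension takes finitely many values there is a rate \<open>b\<close> such that a slightly smaller rate gives
  the same subspace \<open>U\<close>. Then every vector outside \<open>U\<close> is expanded modulo \<open>U\<close> by some word
  (\<open>expanding_word_exists\<close>). By compactness finitely many words suffice
  (\<open>finitely_many_expanding_words\<close>), and applying them greedily for ever produces one signal and one
  trajectory. Because only finitely many words are used, what happens inside a word costs a constant factor
  (\<open>exp_unstable_of_expanding_words\<close>).
\<close>

section \<open>The matrix exponential\<close>

lemma norm_matrix_vector_mult_le: "norm (M *v x) \<le> op_norm M * norm x"
  for M :: "real^'n^'n"
  unfolding op_norm_def by (rule onorm) simp

lemma op_norm_nonneg: "0 \<le> op_norm (M :: real^'n^'n)"
  unfolding op_norm_def by (rule onorm_pos_le) simp

lemma op_norm_le: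
  fixes M :: "real^'n^'n"
  assumes "\<And>x. norm (M *v x) \<le> b * norm x"
  shows "op_norm M \<le> b"
  unfolding op_norm_def using assms by (rule onorm_le)

text \<open>
  The exponential series of the library lives in Banach algebras with a unit of norm one, which square
  matrices with their Euclidean norm in general are not. Operators with the operator norm are, and a type of its own
  carries the multiplication given by composition.
\<close>

typedef (overloaded) ('n::finite) linop = "UNIV :: ((real^'n) \<Rightarrow>\<^sub>L (real^'n)) set" ..

setup_lifting type_definition_linop

instantiation linop :: (finite) real_normed_vector
begin
lift_definition zero_linop :: "'a linop" is 0 .
lift_definition plus_linop :: "'a linop \<Rightarrow> 'a linop \<Rightarrow> 'a linop" is "(+)" .
lift_definition minus_linop :: "'a linop \<Rightarrow> 'a linop \<Rightarrow> 'a linop" is "(-)" .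
lift_definition uminus_linop :: "'a linop \<Rightarrow> 'a linop" is uminus .
lift_definition scaleR_linop :: "real \<Rightarrow> 'a linop \<Rightarrow> 'a linop" is "(*\<^sub>R)" .
lift_definition norm_linop :: "'a linop \<Rightarrow> real" is norm .
definition dist_linop :: "'a linop \<Rightarrow> 'a linop \<Rightarrow> real" where "dist_linop F G = norm (F - G)"
definition sgn_linop :: "'a linop \<Rightarrow> 'a linop" where "sgn_linop F = scaleR (inverse (norm F)) F"
definition uniformity_linop :: "('a linop \<times> 'a linop) filter"
  where "uniformity_linop = (INF e\<in>{0<..}. principal {(F, G). dist F G < e})"
definition open_linop :: "'a linop set \<Rightarrow> bool"
  where "open_linop U = (\<forall>F\<in>U. \<forall>\<^sub>F (F', G) in uniformity. F' = F \<longrightarrow> G \<in> U)"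
instance
proof
  fix F G H :: "'a linop" and r s :: real and U :: "'a linop set"
  show "F + G + H = F + (G + H)" by transfer (simp add: add.assoc)
  show "F + G = G + F" by transfer (simp add: add.commute)
  show "0 + F = F" by transfer simp
  show "- F + F = 0" by transfer simp
  show "F - G = F + - G" by transfer simp
  show "r *\<^sub>R (F + G) = r *\<^sub>R F + r *\<^sub>R G" by transfer (rule scaleR_add_right)
  show "(r + s) *\<^sub>R F = r *\<^sub>R F + s *\<^sub>R F" by transfer (rule scaleR_add_left)
  show "r *\<^sub>R s *\<^sub>R F = (r * s) *\<^sub>R F" by transfer simp
  show "1 *\<^sub>R F = F" by transfer simp
  show "norm F = 0 \<longleftrightarrow> F = 0" by transfer simp
  show "norm (F + G) \<le> norm F + norm G" by transfer (rule norm_triangle_ineq)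
  show "norm (r *\<^sub>R F) = \<bar>r\<bar> * norm F" by transfer simp
  show "dist F G = norm (F - G)" by (rule dist_linop_def)
  show "sgn F = inverse (norm F) *\<^sub>R F" by (rule sgn_linop_def)
  show "uniformity = (INF e\<in>{0<..}. principal {(F :: 'a linop, G). dist F G < e})"
    by (rule uniformity_linop_def)
  show "open U \<longleftrightarrow> (\<forall>F\<in>U. \<forall>\<^sub>F (F', G) in uniformity. F' = F \<longrightarrow> G \<in> U)"
    by (rule open_linop_def)
qed
end

instance linop :: (finite) banach
proof
  fix X :: "nat \<Rightarrow> 'a linop"
  assume "Cauchy X"
  then have "Cauchy (\<lambda>n. Rep_linop (X n))"
    by (simp add: Cauchy_def dist_linop_def dist_norm norm_linop.rep_eq minus_linop.rep_eq)
  then obtain L where "(\<lambda>n. Rep_linop (X n)) \<longlonglongrightarrow> L"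
    by (auto dest!: Cauchy_convergent simp: convergent_def)
  then have "X \<longlonglongrightarrow> Abs_linop L"
    by (simp add: LIMSEQ_def dist_linop_def dist_norm norm_linop.rep_eq minus_linop.rep_eq
        Abs_linop_inverse)
  then show "convergent X" by (rule convergentI)
qed

instantiation linop :: (finite) real_normed_algebra_1
begin
lift_definition one_linop :: "'a linop" is id_blinfun .
lift_definition times_linop :: "'a linop \<Rightarrow> 'a linop \<Rightarrow> 'a linop" is "(o\<^sub>L)" .
instance
proof
  show "F * G * H = F * (G * H)" for F G H :: "'a linop"
    by transfer (auto intro: blinfun_eqI)
  show "1 * F = F" "F * 1 = F" for F :: "'a linop"
    by (transfer; auto intro: blinfun_eqI)+
  show "(F + G) * H = F * H + G * H" "F * (G + H) = F * G + F * H" for F G H :: "'a linop"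
    by (transfer; auto intro!: blinfun_eqI simp: blinfun.bilinear_simps)+
  show "a *\<^sub>R F * G = a *\<^sub>R (F * G)" "F * a *\<^sub>R G = a *\<^sub>R (F * G)" for a and F G :: "'a linop"
    by (transfer; auto intro!: blinfun_eqI simp: blinfun.bilinear_simps)+
  show "norm (F * G) \<le> norm F * norm G" for F G :: "'a linop"
    by transfer (rule norm_blinfun_compose)
  show norm1: "norm (1 :: 'a linop) = 1"
    by transfer (simp add: norm_blinfun.rep_eq onorm_id)
  show "(0 :: 'a linop) \<noteq> 1"
    by (metis norm1 norm_zero zero_neq_one)
qed
end

lift_definition linop_apply :: "('n::finite) linop \<Rightarrow> real^'n \<Rightarrow> real^'n" is blinfun_apply .

lift_definition linop_of :: "real^'n^'n \<Rightarrow> ('n::finite) linop" is "\<lambda>M. Blinfun ((*v) M)" .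

lemma linop_apply_of [simp]: "linop_apply (linop_of M) x = M *v x"
  by transfer (simp add: bounded_linear_Blinfun_apply)

lemma norm_linop_of: "norm (linop_of M) = op_norm M"
  by transfer (simp add: norm_blinfun.rep_eq op_norm_def bounded_linear_Blinfun_apply)

lemma norm_linop_apply_le: "norm (linop_apply F x) \<le> norm F * norm x"
  by transfer (rule norm_blinfun)

lemma bounded_linear_linop_apply: "bounded_linear (\<lambda>F. linop_apply F x)"
proof (rule bounded_linear_intro)
  show "linop_apply (F + G) x = linop_apply F x + linop_apply G x" for F G
    by transfer (rule blinfun.add_left)
  show "linop_apply (r *\<^sub>R F) x = r *\<^sub>R linop_apply F x" for r F
    by transfer (rule blinfun.scaleR_left)
  show "norm (linop_apply F x) \<le> norm F * norm x" for F
    by (rule norm_linop_apply_le)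
qed

lemma linear_linop_apply: "linear (linop_apply F)"
proof (rule linearI)
  show "linop_apply F (x + y) = linop_apply F x + linop_apply F y" for x y
    by transfer (rule blinfun.add_right)
  show "linop_apply F (r *\<^sub>R x) = r *\<^sub>R linop_apply F x" for r x
    by transfer (rule blinfun.scaleR_right)
qed

lemma linop_apply_mult: "linop_apply (F * G) x = linop_apply F (linop_apply G x)"
  by transfer simp

lemma linop_apply_one: "linop_apply 1 x = x"
  by transfer simp

definition mexp :: "real^'n^'n \<Rightarrow> real \<Rightarrow> real^'n^'n" where
  "mexp A t = matrix (linop_apply (exp (t *\<^sub>R linop_of A)))"

lemma mexp_apply: "mexp A t *v x = linop_apply (exp (t *\<^sub>R linop_of A)) x"
  by (simp add: mexp_def matrix_works linear_linop_apply)

lemma mexp_0 [simp]: "mexp A 0 = mat 1"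
  by (simp add: matrix_eq mexp_apply linop_apply_one)

lemma mexp_add: "mexp A (s + t) = mexp A s ** mexp A t"
proof -
  have "exp ((s + t) *\<^sub>R linop_of A) = exp (s *\<^sub>R linop_of A) * exp (t *\<^sub>R linop_of A)"
    by (simp add: scaleR_add_left exp_add_commuting)
  then show ?thesis
    by (simp add: matrix_eq mexp_apply linop_apply_mult matrix_vector_mul_assoc[symmetric])
qed

lemma mexp_has_vector_derivative:
  "((\<lambda>t. mexp A t *v x) has_vector_derivative A *v (mexp A t *v x)) (at t within T)"
proof -
  have "((\<lambda>t. linop_apply (exp (t *\<^sub>R linop_of A)) x) has_vector_derivative
      linop_apply (exp (t *\<^sub>R linop_of A) * linop_of A) x) (at t within T)"
    by (rule bounded_linear.has_vector_derivative[OF bounded_linear_linop_apply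
          exp_scaleR_has_vector_derivative_right])
  then show ?thesis
    by (simp add: mexp_apply linop_apply_mult exp_times_scaleR_commute)
qed

lemma op_norm_mexp_le: "op_norm (mexp A t) \<le> exp (\<bar>t\<bar> * op_norm A)"
proof (rule op_norm_le)
  fix x
  have "norm (mexp A t *v x) \<le> norm (exp (t *\<^sub>R linop_of A)) * norm x"
    unfolding mexp_apply by (rule norm_linop_apply_le)
  also have "\<dots> \<le> exp (\<bar>t\<bar> * op_norm A) * norm x"
    using norm_exp[of "t *\<^sub>R linop_of A"] by (intro mult_right_mono) (simp_all add: norm_linop_of)
  finally show "norm (mexp A t *v x) \<le> exp (\<bar>t\<bar> * op_norm A) * norm x" .
qed

lemma mexp_inverse: "mexp A (- t) *v (mexp A t *v x) = x"
proof -
  have "mexp A (- t) *v (mexp A t *v x) = mexp A (- t + t) *v x"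
    by (simp only: mexp_add matrix_vector_mul_assoc)
  then show ?thesis by simp
qed

section \<open>Uniform growth bounds from the eigenvalues\<close>

text \<open>
  The complexification of a real space is represented by pairs of real and imaginary parts, so that its
  invariant subspaces have a real dimension. A real linear map \<open>A\<close> acts on it as \<open>map_prod A A\<close>, and an
  eigenvector is a nonzero \<open>u\<close> with \<open>map_prod A A u = cscale z u\<close>.
\<close>

definition cscale :: "complex \<Rightarrow> 'a::euclidean_space \<times> 'a \<Rightarrow> 'a \<times> 'a" where
  "cscale z v = (Re z *\<^sub>R fst v - Im z *\<^sub>R snd v, Re z *\<^sub>R snd v + Im z *\<^sub>R fst v)"

lemma cscale_add_left: "cscale (z + w) v = cscale z v + cscale w v"
  by (simp add: cscale_def algebra_simps)

lemma cscale_add_right: "cscale z (v + w) = cscale z v + cscale z w"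
  by (simp add: cscale_def algebra_simps)

lemma cscale_cscale: "cscale z (cscale w v) = cscale (z * w) v"
  by (simp add: cscale_def algebra_simps)

lemma cscale_one [simp]: "cscale 1 v = v"
  by (simp add: cscale_def)

lemma cscale_zero [simp]: "cscale 0 v = 0" "cscale z 0 = 0"
  by (simp_all add: cscale_def zero_prod_def)

lemma cscale_of_real: "cscale (of_real r) v = r *\<^sub>R v"
  by (simp add: cscale_def prod_eq_iff)

lemma cscale_eq_ii: "cscale z v = Re z *\<^sub>R v + Im z *\<^sub>R cscale \<i> v"
  by (simp add: cscale_def prod_eq_iff)

lemma norm_cscale: "norm (cscale z v) = norm z * norm v"
proof -
  have "(norm (cscale z v))\<^sup>2 = cscale z v \<bullet> cscale z v"
    by (rule power2_norm_eq_inner)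
  also have "\<dots> = ((Re z)\<^sup>2 + (Im z)\<^sup>2) * (v \<bullet> v)"
    by (simp add: cscale_def inner_prod_def inner_simps inner_commute power2_eq_square algebra_simps)
  also have "\<dots> = (norm z * norm v)\<^sup>2"
    by (simp only: power_mult_distrib cmod_power2 power2_norm_eq_inner)
  finally show ?thesis by simp
qed

lemma bounded_bilinear_cscale: "bounded_bilinear cscale"
proof
  show "\<exists>K. \<forall>z v. norm (cscale z v :: 'a \<times> 'a) \<le> norm z * norm v * K"
    by (rule exI[of _ 1]) (simp add: norm_cscale)
qed (simp_all add: cscale_def prod_eq_iff algebra_simps)

lemma linear_cscale: "linear (cscale z)"
  using bounded_bilinear.bounded_linear_right[OF bounded_bilinear_cscale]
  by (rule bounded_linear.linear)

lemma linear_map_prod: "linear A \<Longrightarrow> linear (map_prod A A)"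
  for A :: "'a::euclidean_space \<Rightarrow> 'a"
  by (rule linearI) (auto simp: linear_add linear_scale)

lemma map_prod_cscale: "linear A \<Longrightarrow> map_prod A A (cscale z v) = cscale z (map_prod A A v)"
  by (simp add: cscale_def prod_eq_iff linear_add linear_diff linear_scale)

lemma norm_map_prod_le:
  assumes "\<And>x. norm (A x) \<le> M * norm x"
  shows "norm (map_prod A A v) \<le> M * norm v"
proof -
  obtain x y where v: "v = (x, y)" by (cases v)
  have "0 \<le> M * norm v" 
  proof (cases "v = 0")
    case False
    then have "x \<noteq> 0 \<or> y \<noteq> 0" by (auto simp: v zero_prod_def)
    then obtain z where "z \<noteq> (0::'a)" by blast
    moreover have "0 \<le> M * norm z" using assms[of z] norm_ge_zero order_trans by blast
    ultimately show ?thesis by (simp add: zero_le_mult_iff)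
  qed simp
  moreover have "(norm (map_prod A A v))\<^sup>2 \<le> (M * norm v)\<^sup>2"
    using power_mono[OF assms[of x], of 2] power_mono[OF assms[of y], of 2]
    by (simp add: v norm_prod_def power_mult_distrib algebra_simps)
  ultimately show ?thesis
    by (meson power2_le_imp_le)
qed

text \<open>
  Horner evaluation of \<open>p(A) v\<close> for a polynomial with complex coefficients.
\<close>

definition poly_apply :: "('a::euclidean_space \<Rightarrow> 'a) \<Rightarrow> complex poly \<Rightarrow> 'a \<times> 'a \<Rightarrow> 'a \<times> 'a" where
  "poly_apply A p v = fold_coeffs (\<lambda>a w. cscale a v + map_prod A A w) p 0"

lemma poly_apply_0 [simp]: "poly_apply A 0 v = 0"
  by (simp add: poly_apply_def)

lemma poly_apply_pCons:
  "linear A \<Longrightarrow> poly_apply A (pCons a p) v = cscale a v + map_prod A A (poly_apply A p v)"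
  by (cases "p = 0 \<and> a = 0")
    (auto simp: poly_apply_def linear_0[OF linear_map_prod])

lemma poly_apply_add:
  assumes "linear A"
  shows "poly_apply A (p + q) v = poly_apply A p v + poly_apply A q v"
  by (induction p q rule: poly_induct2)
    (simp_all add: assms poly_apply_pCons cscale_add_left linear_add[OF linear_map_prod[OF assms]])

lemma poly_apply_smult:
  assumes "linear A"
  shows "poly_apply A (smult c p) v = cscale c (poly_apply A p v)"
  by (induction p)
    (simp_all add: assms poly_apply_pCons cscale_cscale cscale_add_right map_prod_cscale)

lemma poly_apply_linear_factor:
  assumes "linear A"
  shows "poly_apply A ([:- z, 1:] * p) v = map_prod A A (poly_apply A p v) - cscale z (poly_apply A p v)"
proof -
  have "[:- z, 1:] * p = smult (- z) p + pCons 0 p"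
    by simp
  moreover have "cscale (- z) w = - cscale z w" for w :: "'a \<times> 'a"
    by (simp add: cscale_def)
  ultimately show ?thesis
    by (simp only: poly_apply_add[OF assms] poly_apply_smult[OF assms] poly_apply_pCons[OF assms] cscale_zero) simp
qed

lemma poly_apply_monom:
  assumes "linear A"
  shows "poly_apply A (monom c i) v = cscale c ((map_prod A A ^^ i) v)"
  by (induction i)
    (simp_all add: assms monom_0 monom_Suc poly_apply_pCons map_prod_cscale
      linear_0[OF linear_map_prod[OF assms]])

lemma poly_apply_sum:
  assumes "linear A"
  shows "poly_apply A (sum p I) v = (\<Sum>i\<in>I. poly_apply A (p i) v)"
  by (induction I rule: infinite_finite_induct) (simp_all add: poly_apply_add[OF assms])

lemma poly_apply_in:
  assumes A: "linear A" and W: "subspace W" "\<And>w. w \<in> W \<Longrightarrow> map_prod A A w \<in> W"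
    and "\<And>w. w \<in> W \<Longrightarrow> cscale \<i> w \<in> W" "v \<in> W"
  shows "poly_apply A p v \<in> W"
proof (induction p)
  case (pCons a p)
  have "cscale a v \<in> W"
    by (subst cscale_eq_ii) (intro subspace_add subspace_scale assms)
  then show ?case
    by (simp only: poly_apply_pCons[OF A]) (intro subspace_add W pCons)
qed (simp add: subspace_0 W)

text \<open>
  More iterates \<open>v\<close>, \<open>A v\<close>, \<open>A\<^sup>2 v\<close>, \<open>\<dots>\<close> than the dimension are linearly dependent, or two of them coincide.
\<close>

lemma annihilating_poly_exists:
  fixes A :: "'a::euclidean_space \<Rightarrow> 'a"
  assumes A: "linear A"
  shows "\<exists>p. p \<noteq> 0 \<and> poly_apply A p v = 0"
proof -
  define N where "N = DIM('a \<times> 'a)"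
  define f where "f i = (map_prod A A ^^ i) v" for i
  show ?thesis
  proof (cases "inj_on f {..N}")
    case False
    then obtain i j where ij: "i \<noteq> j" "f i = f j" by (auto simp: inj_on_def)
    define p where "p = monom 1 i + monom (-1::complex) j"
    have "coeff p i = 1" using ij by (simp add: p_def)
    then have "p \<noteq> 0" by auto
    moreover have "poly_apply A p v = f i + cscale (-1) (f j)"
      by (simp add: p_def poly_apply_add[OF A] poly_apply_monom[OF A] f_def)
    then have "poly_apply A p v = 0" using ij by (simp add: cscale_def prod_eq_iff)
    ultimately show ?thesis by blast
  next
    case True
    have "card (f ` {..N}) = Suc N" using True by (simp add: card_image)
    then have "dependent (f ` {..N})"
      using independent_bound[of "f ` {..N}"] by (auto simp: N_def)
    then have "\<exists>u. (\<exists>w\<in>f ` {..N}. u w \<noteq> 0) \<and> (\<Sum>x\<in>f ` {..N}. u x *\<^sub>R x) = 0"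
      using dependent_finite[of "f ` {..N}"] by simp
    then obtain u w where u: "w \<in> f ` {..N}" "u w \<noteq> 0" "(\<Sum>x\<in>f ` {..N}. u x *\<^sub>R x) = 0"
      by blast
    from u(1) obtain k where k: "k \<le> N" "w = f k" by auto
    define p where "p = (\<Sum>i\<le>N. monom (complex_of_real (u (f i))) i)"
    have "coeff p k = complex_of_real (u w)"
      using k by (simp add: p_def coeff_sum coeff_monom)
    then have "p \<noteq> 0" using u(2) by auto
    moreover have "poly_apply A p v = (\<Sum>i\<le>N. u (f i) *\<^sub>R f i)"
      by (simp add: p_def poly_apply_sum[OF A] poly_apply_monom[OF A] cscale_of_real f_def)
    then have "poly_apply A p v = 0" using u(3) by (simp add: sum.reindex[OF True])
    ultimately show ?thesis by blast
  qed
qed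

text \<open>
  Split off linear factors of a polynomial that annihilates \<open>v\<close>. The last vector before the product
  becomes zero is an eigenvector, and it lies in every complex invariant subspace that contains \<open>v\<close>.
\<close>

lemma invariant_subspace_eigenvector:
  fixes A :: "'a::euclidean_space \<Rightarrow> 'a"
  assumes A: "linear A" and W: "subspace W" "\<And>w. w \<in> W \<Longrightarrow> map_prod A A w \<in> W"
    "\<And>w. w \<in> W \<Longrightarrow> cscale \<i> w \<in> W" and "v \<in> W" "v \<noteq> 0"
  shows "\<exists>z u. u \<in> W \<and> u \<noteq> 0 \<and> map_prod A A u = cscale z u"
proof -
  have *: "\<exists>z u. u \<in> W \<and> u \<noteq> 0 \<and> map_prod A A u = cscale z u"
    if "p \<noteq> 0" "poly_apply A p v = 0" for p
    using that
  proof (induction "degree p" arbitrary: p rule: less_induct)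
    case less
    show ?case
    proof (cases "degree p = 0")
      case True
      then obtain c where c: "p = [:c:]" by (metis degree_eq_zeroE)
      then have "c \<noteq> 0" using less by auto
      have "cscale c v = 0"
        using less c by (simp add: poly_apply_pCons[OF A] linear_0[OF linear_map_prod[OF A]])
      then have "norm c * norm v = 0" by (metis norm_cscale norm_zero)
      with \<open>c \<noteq> 0\<close> \<open>v \<noteq> 0\<close> show ?thesis by simp
    next
      case False
      then have "\<not> constant (poly p)" by (simp add: constant_degree)
      then obtain z where "poly p z = 0" using fundamental_theorem_of_algebra by blast
      then obtain q where q: "p = [:- z, 1:] * q" by (metis dvdE poly_eq_0_iff_dvd)
      then have "q \<noteq> 0" using less by auto
      have "degree p = degree [:- z, 1:] + degree q"
        unfolding q by (rule degree_mult_eq) (use \<open>q \<noteq> 0\<close> in auto)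
      then have deg: "degree q < degree p" by simp
      show ?thesis
      proof (cases "poly_apply A q v = 0")
        case True
        with less.hyps[OF deg \<open>q \<noteq> 0\<close>] show ?thesis by blast
      next
        case False
        have "map_prod A A (poly_apply A q v) = cscale z (poly_apply A q v)"
          using less.prems(2) unfolding q poly_apply_linear_factor[OF A] by simp
        with False poly_apply_in[OF A W \<open>v \<in> W\<close>] show ?thesis by blast
      qed
    qed
  qed
  with annihilating_poly_exists[OF A] show ?thesis by blast
qed

text \<open>
  A basis of \<open>W\<close> that contains \<open>u\<close> loses an element under \<open>g\<close>.
\<close>

lemma dim_image_less:
  fixes g :: "'b::euclidean_space \<Rightarrow> 'b"
  assumes "linear g" "subspace W" "u \<in> W" "u \<noteq> 0" "g u = 0"
  shows "dim (g ` W) < dim W"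
proof -
  have "independent {u}" using assms by simp
  then obtain B where B: "{u} \<subseteq> B" "B \<subseteq> W" "independent B" "W \<subseteq> span B"
    using maximal_independent_subset_extend[of "{u}" W] assms(3) by blast
  have fin: "finite B" using B(3) by (rule finiteI_independent)
  have "W = span B" using B assms(2) by (metis span_minimal subset_antisym)
  have "g ` W \<subseteq> span (g ` B)"
    unfolding \<open>W = span B\<close> by (simp add: linear_span_image[OF assms(1)])
  also have "g ` B = insert 0 (g ` (B - {u}))" using B(1) assms(5) by auto
  also have "span \<dots> = span (g ` (B - {u}))" by (simp add: span_insert_0)
  finally have "dim (g ` W) \<le> card (g ` (B - {u}))"
    using fin by (intro dim_le_card) auto
  also have "\<dots> \<le> card (B - {u})" using fin by (intro card_image_le) auto
  also have "\<dots> < card B" using fin B(1) by (intro psubset_card_mono) auto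
  also have "card B = dim W" using B by (simp add: basis_card_eq_dim)
  finally show ?thesis .
qed

text \<open>
  Variation of constants in the form of a mean value inequality: the derivative of \<open>e\<^bsup>- z t\<^esup> f(t)\<close> is
  \<open>e\<^bsup>- z t\<^esup> g(t)\<close>. The gap between \<open>c'\<close> and \<open>c\<close> keeps the rate \<open>c\<close> and lets only the constant grow, so the
  estimate can be iterated.
\<close>

lemma forced_scalar_ode_bound:
  fixes f g :: "real \<Rightarrow> 'a::euclidean_space \<times> 'a"
  assumes f: "\<And>t. (f has_vector_derivative cscale z (f t) + g t) (at t)"
    and g: "\<And>t. t \<ge> 0 \<Longrightarrow> norm (g t) \<le> C * exp (c * t)"
    and "Re z \<le> c'" "c' < c" "0 \<le> C" "t \<ge> 0"
  shows "norm (f t) \<le> (norm (f 0) + C / (c - c')) * exp (c * t)"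
proof (cases "t = 0")
  case True
  then show ?thesis using assms by simp
next
  case False
  define a where "a = Re z"
  define e where "e s = exp (- (z * complex_of_real s))" for s
  define h where "h s = cscale (e s) (f s)" for s
  \<comment> \<open>\<open>\<phi>\<close> is an antiderivative of the bound on the derivative of \<open>h\<close>\<close>
  define \<phi> where "\<phi> s = C / (c - a) * exp ((c - a) * s)" for s
  have ac: "a < c" using assms by (simp add: a_def)
  have norm_e: "norm (e s) = exp (- (a * s))" for s by (simp add: e_def a_def)
  have e': "(e has_vector_derivative - z * e s) (at s)" for s
    unfolding e_def by (rule has_vector_derivative_real_field) (auto intro!: derivative_eq_intros)
  have h': "(h has_vector_derivative cscale (e s) (g s)) (at s)" for s
  proof -
    have "(h has_vector_derivative cscale (e s) (cscale z (f s) + g s) + cscale (- z * e s) (f s)) (at s)"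
      unfolding h_def
      by (rule bounded_bilinear.has_vector_derivative[OF bounded_bilinear_cscale e' f])
    also have "cscale (e s) (cscale z (f s) + g s) + cscale (- z * e s) (f s) = cscale (e s) (g s)"
      by (simp add: cscale_add_right cscale_cscale)
        (simp add: mult.commute cscale_add_left[symmetric] add.assoc[symmetric] add.commute)
    finally show ?thesis .
  qed
  have \<phi>': "(\<phi> has_vector_derivative C * exp ((c - a) * s)) (at s)" for s
    unfolding \<phi>_def has_real_derivative_iff_has_vector_derivative[symmetric]
    using ac by (auto intro!: derivative_eq_intros)
  have "norm (h t - h 0) \<le> \<phi> t - \<phi> 0"
  proof (rule differentiable_bound_general[OF _ _ _ h' \<phi>'])
    show "0 < t" using False assms by simp
    show "continuous_on {0..t} h"
      using h' by (intro continuous_at_imp_continuous_on) (auto intro: has_vector_derivative_continuous)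
    show "continuous_on {0..t} \<phi>" unfolding \<phi>_def by (intro continuous_intros)
    show "norm (cscale (e s) (g s)) \<le> C * exp ((c - a) * s)" if "0 < s" for s
    proof -
      have "norm (cscale (e s) (g s)) \<le> exp (- (a * s)) * (C * exp (c * s))"
        unfolding norm_cscale norm_e using g[of s] that by (intro mult_left_mono) auto
      then show ?thesis by (simp add: algebra_simps exp_add[symmetric] exp_diff exp_minus field_simps)
    qed
  qed
  moreover have "0 \<le> \<phi> 0" using ac assms by (simp add: \<phi>_def)
  moreover have "h 0 = f 0" by (simp add: h_def e_def)
  ultimately have "norm (h t) \<le> norm (f 0) + \<phi> t"
    using norm_triangle_ineq2[of "h t" "h 0"] by simp
  then have 1: "exp (a * t) * norm (h t) \<le> exp (a * t) * (norm (f 0) + \<phi> t)"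
    by (intro mult_left_mono) auto
  have 2: "exp (a * t) * norm (h t) = norm (f t)"
    by (simp add: h_def norm_cscale norm_e exp_minus)
  have 3: "exp (a * t) * norm (f 0) \<le> norm (f 0) * exp (c * t)"
    using ac assms by (subst mult.commute) (intro mult_left_mono; simp add: mult_right_mono)
  have 4: "exp (a * t) * \<phi> t = C / (c - a) * exp (c * t)"
    by (simp add: \<phi>_def exp_add[symmetric] algebra_simps)
  have "C / (c - a) \<le> C / (c - c')"
    using assms by (intro divide_left_mono) (auto simp: a_def)
  then have 5: "C / (c - a) * exp (c * t) \<le> C / (c - c') * exp (c * t)"
    by (intro mult_right_mono) auto
  from 1 have "norm (f t) \<le> exp (a * t) * norm (f 0) + exp (a * t) * \<phi> t"
    unfolding 2 by (simp only: distrib_left)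
  also have "\<dots> \<le> norm (f 0) * exp (c * t) + C / (c - c') * exp (c * t)"
    unfolding 4 by (intro add_mono 3 5)
  finally show ?thesis by (simp only: distrib_right)
qed

text \<open>
  The point is that the constant depends only on \<open>M\<close>, the two rates and the dimension, and not on \<open>A\<close>: a single
  matrix would only give a constant of its own, which could blow up along a bounded family of matrices.
  For an eigenvalue \<open>z\<close> with an eigenvector in \<open>W\<close>, the function \<open>(A - z) f\<close> solves the same equation in the
  smaller invariant subspace \<open>(A - z) W\<close>, and it is the forcing term in \<open>f' = z f + (A - z) f\<close>. Since
  \<open>|z| \<le> M\<close>, each dimension contributes one more power of \<open>2 M / (c - c')\<close>.
\<close>

lemma linear_ode_growth_on_invariant_subspace:
  fixes A :: "'a::euclidean_space \<Rightarrow> 'a"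
  assumes c: "c' < c" and A: "linear A" and M: "0 \<le> M" "\<And>x. norm (A x) \<le> M * norm x"
    and ev: "\<And>z u. u \<noteq> 0 \<Longrightarrow> map_prod A A u = cscale z u \<Longrightarrow> Re z \<le> c'"
  shows "subspace W \<Longrightarrow> (\<And>w. w \<in> W \<Longrightarrow> map_prod A A w \<in> W) \<Longrightarrow> (\<And>w. w \<in> W \<Longrightarrow> cscale \<i> w \<in> W) \<Longrightarrow>
    dim W \<le> m \<Longrightarrow> (\<And>t. f t \<in> W) \<Longrightarrow>
    (\<And>t. (f has_vector_derivative map_prod A A (f t)) (at t)) \<Longrightarrow> t \<ge> 0 \<Longrightarrow>
    norm (f t) \<le> (\<Sum>i<m. (2 * M / (c - c')) ^ i) * norm (f 0) * exp (c * t)"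
proof (induction m arbitrary: W f t)
  case 0
  then have "f t = 0" by (metis dim_eq_0 le_zero_eq singletonD subsetD)
  then show ?case by simp
next
  case (Suc m)
  note W = Suc.prems(1-3) and fW = Suc.prems(5) and f' = Suc.prems(6)
  define q K where "q = 2 * M / (c - c')" and "K = (\<Sum>i<m. q ^ i)"
  have "0 \<le> q" using c M by (simp add: q_def)
  then have K: "0 \<le> K" by (auto simp: K_def intro: sum_nonneg)
  have K_Suc: "(\<Sum>i<Suc m. q ^ i) = 1 + q * K"
    unfolding K_def by (subst sum.lessThan_Suc_shift) (simp add: sum_distrib_left)
  show ?case
  proof (cases "\<exists>w\<in>W. w \<noteq> 0")
    case False
    then have "f t = 0" using fW[of t] by blast
    then have "norm (f t) = 0" by simp
    also have "0 \<le> (1 + q * K) * norm (f 0) * exp (c * t)" using K \<open>0 \<le> q\<close> by simp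
    finally show ?thesis unfolding q_def[symmetric] K_Suc .
  next
    case True
    then obtain z u where u: "u \<in> W" "u \<noteq> 0" "map_prod A A u = cscale z u"
      using invariant_subspace_eigenvector[OF A W] by blast
    have z: "norm z \<le> M"
      using norm_map_prod_le[of A M u, OF M(2)] u(2) by (simp add: u(3) norm_cscale)
    define G where "G v = map_prod A A v - cscale z v" for v
    have G: "linear G"
      unfolding G_def by (intro linear_compose_sub linear_map_prod linear_cscale A)
    have AG: "map_prod A A (G v) = G (map_prod A A v)" for v
      by (simp only: G_def linear_diff[OF linear_map_prod[OF A]] map_prod_cscale[OF A])
    have iG: "cscale \<i> (G v) = G (cscale \<i> v)" for v
      by (simp only: G_def linear_diff[OF linear_cscale] map_prod_cscale[OF A] cscale_cscale mult.commute)
    have normG: "norm (G v) \<le> 2 * M * norm v" for v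
    proof -
      have "norm (G v) \<le> norm (map_prod A A v) + norm (cscale z v)"
        unfolding G_def by (rule norm_triangle_ineq4)
      also have "\<dots> \<le> M * norm v + M * norm v"
        unfolding norm_cscale by (intro add_mono norm_map_prod_le M mult_right_mono z) auto
      finally show ?thesis by simp
    qed
    have IH: "norm (G (f s)) \<le> K * norm (G (f 0)) * exp (c * s)" if "s \<ge> 0" for s
      unfolding K_def q_def
    proof (rule Suc.IH[where W = "G ` W" and f = "\<lambda>s. G (f s)"])
      show "subspace (G ` W)" by (intro linear_subspace_image G W)
      show "map_prod A A w \<in> G ` W" if "w \<in> G ` W" for w using that W(2) AG by auto
      show "cscale \<i> w \<in> G ` W" if "w \<in> G ` W" for w using that W(3) iG by auto
      show "dim (G ` W) \<le> m"
        using dim_image_less[OF G W(1) u(1,2)] u(3) Suc.prems(4) by (simp add: G_def)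
      show "G (f t) \<in> G ` W" for t by (intro imageI fW)
      show "((\<lambda>s. G (f s)) has_vector_derivative map_prod A A (G (f t))) (at t)" for t
        unfolding AG
        by (rule bounded_linear.has_vector_derivative[OF linear_conv_bounded_linear[THEN iffD1, OF G] f'])
      show "0 \<le> s" by (rule that)
    qed
    have Gf: "norm (G (f s)) \<le> K * (2 * M * norm (f 0)) * exp (c * s)" if "s \<ge> 0" for s
      by (rule order_trans[OF IH[OF that]])
        (intro mult_right_mono mult_left_mono normG K; simp)
    have "norm (f t) \<le> (norm (f 0) + K * (2 * M * norm (f 0)) / (c - c')) * exp (c * t)"
    proof (rule forced_scalar_ode_bound[of f z "\<lambda>s. G (f s)"])
      show "(f has_vector_derivative cscale z (f s) + G (f s)) (at s)" for s
        using f' by (simp add: G_def)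
      show "Re z \<le> c'" using ev u by blast
      show "0 \<le> K * (2 * M * norm (f 0))" using K M by simp
    qed (use Gf c Suc.prems(7) in auto)
    also have "norm (f 0) + K * (2 * M * norm (f 0)) / (c - c') = (1 + q * K) * norm (f 0)"
      by (simp add: q_def algebra_simps)
    finally show ?thesis unfolding q_def[symmetric] K_Suc .
  qed
qed

section \<open>Expanding words in a semigroup of linear maps\<close>

lemma orthonormal_expansion:
  fixes U :: "'a::euclidean_space set"
  assumes "subspace U"
  obtains B where "finite B" "B \<subseteq> U" "\<And>v. v \<in> B \<Longrightarrow> norm v = 1" "\<And>x. x \<in> U \<Longrightarrow> (\<Sum>v\<in>B. (v \<bullet> x) *\<^sub>R v) = x"
proof -
  obtain B where B: "B \<subseteq> U" "pairwise orthogonal B" "\<And>x. x \<in> B \<Longrightarrow> norm x = 1"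
    "independent B" "span B = U"
    using orthonormal_basis_subspace[OF assms] by metis
  have fin: "finite B" using B(4) by (rule finiteI_independent)
  have "(\<Sum>v\<in>B. (v \<bullet> x) *\<^sub>R v) = x" if "x \<in> U" for x
  proof (rule linear_eq_on_span[of "\<lambda>x. \<Sum>v\<in>B. (v \<bullet> x) *\<^sub>R v" "\<lambda>x. x" B x])
    show "linear (\<lambda>x. \<Sum>v\<in>B. (v \<bullet> x) *\<^sub>R v)"
      by (intro linear_compose_sum ballI linearI) (simp_all add: inner_add_right scaleR_add_left)
    show "linear (\<lambda>x :: 'a. x)" by (rule linear_ident)
    show "x \<in> span B" using that B by simp
    fix w assume w: "w \<in> B"
    have "(\<Sum>v\<in>B. (v \<bullet> w) *\<^sub>R v) = (\<Sum>v\<in>B. if v = w then w else 0)"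
    proof (rule sum.cong)
      fix v assume "v \<in> B"
      then show "(v \<bullet> w) *\<^sub>R v = (if v = w then w else 0)"
        using B(2,3) w by (auto simp: pairwise_def orthogonal_def norm_eq_1)
    qed simp
    then show "(\<Sum>v\<in>B. (v \<bullet> w) *\<^sub>R v) = w" using w fin by simp
  qed
  with that fin B show ?thesis by blast
qed

lemma projection_along_subspace:
  fixes U :: "'a::euclidean_space set"
  assumes "subspace U"
  obtains p :: "'a \<Rightarrow> 'a" where "linear p" "\<And>x. p x = 0 \<longleftrightarrow> x \<in> U" "\<And>x. x - p x \<in> U"
proof -
  obtain B where B: "finite B" "B \<subseteq> U" "\<And>x. x \<in> U \<Longrightarrow> (\<Sum>v\<in>B. (v \<bullet> x) *\<^sub>R v) = x"
    using orthonormal_expansion[OF assms] by metis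
  define p where "p x = x - (\<Sum>v\<in>B. (v \<bullet> x) *\<^sub>R v)" for x
  have "linear p"
    unfolding p_def
    by (intro linear_compose_sub linear_ident linear_compose_sum ballI linearI)
      (simp_all add: inner_add_right scaleR_add_left)
  moreover have in_U: "(\<Sum>v\<in>B. (v \<bullet> x) *\<^sub>R v) \<in> U" for x
    using B(2) by (intro subspace_sum[OF assms] subspace_scale[OF assms]) auto
  moreover have "p x = 0 \<longleftrightarrow> x \<in> U" for x
    using in_U[of x] B(3)[of x] by (auto simp: p_def)
  ultimately show ?thesis using that[of p] by (simp add: p_def)
qed

text \<open>
  A semigroup of linear maps generated by maps \<open>m g\<close>, each with a duration. Durations of at least one bound
  the number of letters of a word by its duration. The rate \<open>c\<close> bounds single letters, which may be arbitrarily
  long; the results below concern growth of words at rates above \<open>c\<close>. Words act from left to right.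
\<close>

locale timed_generators =
  fixes G :: "'g set" and m :: "'g \<Rightarrow> 'a::euclidean_space \<Rightarrow> 'a" and d :: "'g \<Rightarrow> real"
    and K c :: real
  assumes linear_m: "g \<in> G \<Longrightarrow> linear (m g)"
    and d_ge_1: "g \<in> G \<Longrightarrow> 1 \<le> d g"
    and norm_m_le: "g \<in> G \<Longrightarrow> norm (m g x) \<le> K * exp (c * d g) * norm x"
    and K_nonneg: "0 \<le> K"
begin

definition dur :: "'g list \<Rightarrow> real" where
  "dur l = sum_list (map d l)"

definition tame :: "real \<Rightarrow> 'a set" where
  "tame b = {x. \<exists>C. \<forall>l\<in>lists G. norm (fold m l x) \<le> C * exp (b * dur l)}"

lemma dur_simps [simp]: "dur [] = 0" "dur (g # l) = d g + dur l" "dur (l @ l') = dur l + dur l'"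
  by (simp_all add: dur_def)

lemma length_le_dur: "l \<in> lists G \<Longrightarrow> real (length l) \<le> dur l"
  by (induction l) (use d_ge_1 in force)+

lemma linear_fold: "l \<in> lists G \<Longrightarrow> linear (fold m l)"
proof (induction l)
  case (Cons g l)
  then show ?case using linear_compose[of "m g" "fold m l"] linear_m by (auto simp: o_def)
qed (simp add: linear_id)

lemma subspace_tame: "subspace (tame b)"
proof (rule subspaceI)
  show "0 \<in> tame b"
    unfolding tame_def by (auto intro!: exI[of _ 0] simp: linear_0 linear_fold)
next
  fix x y assume "x \<in> tame b" "y \<in> tame b"
  then obtain C C' where C: "\<And>l. l \<in> lists G \<Longrightarrow> norm (fold m l x) \<le> C * exp (b * dur l)"
    "\<And>l. l \<in> lists G \<Longrightarrow> norm (fold m l y) \<le> C' * exp (b * dur l)"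
    unfolding tame_def by blast
  have "norm (fold m l (x + y)) \<le> (C + C') * exp (b * dur l)" if "l \<in> lists G" for l
    using norm_triangle_ineq[of "fold m l x" "fold m l y"] C[OF that]
    by (simp add: linear_add[OF linear_fold[OF that]] distrib_right)
  then show "x + y \<in> tame b" unfolding tame_def by blast
next
  fix r x assume "x \<in> tame b"
  then obtain C where C: "\<And>l. l \<in> lists G \<Longrightarrow> norm (fold m l x) \<le> C * exp (b * dur l)"
    unfolding tame_def by blast
  have "norm (fold m l (r *\<^sub>R x)) \<le> (\<bar>r\<bar> * C) * exp (b * dur l)" if "l \<in> lists G" for l
    using mult_left_mono[OF C[OF that], of "\<bar>r\<bar>"]
    by (simp add: linear_scale[OF linear_fold[OF that]] mult.assoc)
  then show "r *\<^sub>R x \<in> tame b" unfolding tame_def by blast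
qed

lemma tame_step:
  assumes "x \<in> tame b" "g \<in> G"
  shows "m g x \<in> tame b"
proof -
  obtain C where C: "\<And>l. l \<in> lists G \<Longrightarrow> norm (fold m l x) \<le> C * exp (b * dur l)"
    using assms unfolding tame_def by blast
  have "norm (fold m l (m g x)) \<le> (C * exp (b * d g)) * exp (b * dur l)" if "l \<in> lists G" for l
    using C[of "g # l"] that assms by (simp add: exp_add algebra_simps)
  then show ?thesis unfolding tame_def by blast
qed

lemma tame_fold: "l \<in> lists G \<Longrightarrow> x \<in> tame b \<Longrightarrow> fold m l x \<in> tame b"
  by (induction l arbitrary: x) (auto simp: tame_step)

lemma tame_mono:
  assumes "b \<le> b'"
  shows "tame b \<subseteq> tame b'"
proof
  fix x assume "x \<in> tame b"
  then obtain C where C: "\<And>l. l \<in> lists G \<Longrightarrow> norm (fold m l x) \<le> C * exp (b * dur l)"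
    unfolding tame_def by blast
  have "norm (fold m l x) \<le> C * exp (b' * dur l)" if "l \<in> lists G" for l
  proof (rule order_trans[OF C[OF that]])
    have "0 \<le> C" using order_trans[OF norm_ge_zero C[of "[]"]] by simp
    moreover have "0 \<le> dur l" using length_le_dur[OF that] by linarith
    ultimately show "C * exp (b * dur l) \<le> C * exp (b' * dur l)"
      using assms by (intro mult_left_mono) (auto intro: mult_right_mono)
  qed
  then show "x \<in> tame b'" unfolding tame_def by blast
qed

lemma tame_uniform:
  obtains C where "0 \<le> C"
    "\<And>l x. l \<in> lists G \<Longrightarrow> x \<in> tame b \<Longrightarrow> norm (fold m l x) \<le> C * norm x * exp (b * dur l)"
proof -
  obtain B where B: "finite B" "B \<subseteq> tame b" "\<And>v. v \<in> B \<Longrightarrow> norm v = 1"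
    "\<And>x. x \<in> tame b \<Longrightarrow> (\<Sum>v\<in>B. (v \<bullet> x) *\<^sub>R v) = x"
    using orthonormal_expansion[OF subspace_tame] by metis
  have "\<forall>v\<in>B. \<exists>C. \<forall>l\<in>lists G. norm (fold m l v) \<le> C * exp (b * dur l)"
    using B(2) unfolding tame_def by blast
  then obtain C where C: "\<And>v l. v \<in> B \<Longrightarrow> l \<in> lists G \<Longrightarrow> norm (fold m l v) \<le> C v * exp (b * dur l)"
    by metis
  have C0: "0 \<le> C v" if "v \<in> B" for v
    using order_trans[OF norm_ge_zero C[of v "[]"]] that by simp
  show ?thesis
  proof (rule that[of "sum C B"])
    show "0 \<le> sum C B" using C0 by (rule sum_nonneg)
    fix l x assume l: "l \<in> lists G" and x: "x \<in> tame b"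
    have "fold m l x = fold m l (\<Sum>v\<in>B. (v \<bullet> x) *\<^sub>R v)" using B(4)[OF x] by simp
    also have "\<dots> = (\<Sum>v\<in>B. (v \<bullet> x) *\<^sub>R fold m l v)"
      by (simp add: linear_sum[OF linear_fold[OF l]] linear_scale[OF linear_fold[OF l]])
    also have "norm \<dots> \<le> (\<Sum>v\<in>B. norm x * (C v * exp (b * dur l)))"
    proof (rule sum_norm_le)
      fix v assume v: "v \<in> B"
      have "\<bar>v \<bullet> x\<bar> \<le> norm x" using Cauchy_Schwarz_ineq2[of v x] B(3)[OF v] by simp
      then show "norm ((v \<bullet> x) *\<^sub>R fold m l v) \<le> norm x * (C v * exp (b * dur l))"
        unfolding norm_scaleR using C[OF v l] by (intro mult_mono) auto
    qed
    also have "\<dots> = sum C B * norm x * exp (b * dur l)"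
      by (simp add: sum_distrib_left sum_distrib_right ac_simps)
    finally show "norm (fold m l x) \<le> sum C B * norm x * exp (b * dur l)" .
  qed
qed

text \<open>
  Smaller rates give smaller tame subspaces. At a rate where the dimension is minimal, lowering the rate
  cannot change the subspace any more.
\<close>

lemma stable_rate_exists:
  assumes "c < a"
  obtains b b' where "c < b'" "b' < b" "b < a" "tame b' = tame b"
proof -
  obtain b where b: "c < b \<and> b < a" and min: "\<And>b'. c < b' \<and> b' < a \<Longrightarrow> dim (tame b) \<le> dim (tame b')"
    using ex_has_least_nat[of "\<lambda>b. c < b \<and> b < a" "(a + c) / 2" "\<lambda>b. dim (tame b)"] assms
    by (auto simp: field_simps)
  define b' where "b' = (c + b) / 2"
  have b': "c < b'" "b' < b" using b by (auto simp: b'_def)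
  have "tame b' = tame b"
    using subspace_dim_equal[OF subspace_tame subspace_tame tame_mono] b' b min[of b'] by simp
  with that b b' show ?thesis by blast
qed

text \<open>
  Suppose that no word expands \<open>w\<close> modulo \<open>U = tame b\<close> at rate \<open>b'\<close>, and split the orbit into \<open>p x\<close> and the
  component \<open>q x = x - p x\<close> in \<open>U\<close>. The first part is bounded by \<open>e\<^bsup>b' t\<^esup>\<close> by assumption. The second part grows at rate
  \<open>b'\<close> by itself, as \<open>U = tame b'\<close>, and each letter adds a forcing term from the first part, which contributes a
  multiple of \<open>e\<^bsup>b' t\<^esup>\<close> since the letters have rate \<open>c \<le> b'\<close>. There are at most \<open>t\<close> letters, so the whole orbit is
  bounded by a multiple of \<open>(1 + t) e\<^bsup>b' t\<^esup>\<close>, hence of \<open>e\<^bsup>b t\<^esup>\<close>, and \<open>w\<close> would be tame.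
\<close>

lemma expanding_word_exists:
  assumes rates: "c \<le> b'" "b' < b" "tame b' = tame b" and w: "w \<notin> tame b"
    and p: "linear p" "\<And>x. p x = 0 \<longleftrightarrow> x \<in> tame b" "\<And>x. x - p x \<in> tame b"
  shows "\<exists>l\<in>lists G. exp (b' * dur l) * norm (p w) < norm (p (fold m l w))"
proof (rule ccontr)
  assume neg: "\<not> ?thesis"
  then have quot: "norm (p (fold m l w)) \<le> exp (b' * dur l) * norm (p w)" if "l \<in> lists G" for l
    using that by (auto simp: not_less)
  obtain C where C: "0 \<le> C"
    "\<And>l x. l \<in> lists G \<Longrightarrow> x \<in> tame b \<Longrightarrow> norm (fold m l x) \<le> C * norm x * exp (b' * dur l)"
    using tame_uniform[of b'] rates(3) by metis
  define q where "q x = x - p x" for x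
  have q: "linear q" unfolding q_def by (intro linear_compose_sub linear_ident p)
  then obtain \<kappa> where \<kappa>: "0 \<le> \<kappa>" "\<And>x. norm (q x) \<le> \<kappa> * norm x"
    using linear_bounded_pos[OF q] by (metis less_imp_le)
  define R where "R = C * \<kappa> * K * norm (p w)"
  have R: "0 \<le> R" using C \<kappa> K_nonneg by (simp add: R_def)
  \<comment> \<open>The further word \<open>l2\<close> lets the induction apply the rate bound on \<open>U\<close> once to the remaining word; letter by
    letter its constant \<open>C\<close> would be multiplied each time.\<close>
  have main: "norm (fold m l2 (q (fold m l w))) \<le> exp (b' * (dur l + dur l2)) * (C * norm (q w) + real (length l) * R)"
    if "l \<in> lists G" "l2 \<in> lists G" for l l2
    using that
  proof (induction l arbitrary: l2 rule: rev_induct)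
    case Nil
    then show ?case using C(2)[of l2 "q w"] p(3) by (simp add: q_def mult.commute)
  next
    case (snoc g l)
    then have g: "g \<in> G" and l: "l \<in> lists G" by auto
    define x where "x = fold m l w"
    have "m g x = m g (q x) + m g (p x)"
      using linear_add[OF linear_m[OF g], of "q x" "p x"] by (simp add: q_def)
    moreover have "q (m g (q x)) = m g (q x)"
      using p(2,3) tame_step[OF _ g] by (simp add: q_def)
    ultimately have "q (m g x) = m g (q x) + q (m g (p x))"
      by (simp add: linear_add[OF q])
    then have "fold m l2 (q (fold m (l @ [g]) w)) = fold m (g # l2) (q x) + fold m l2 (q (m g (p x)))"
      using snoc.prems by (simp add: x_def linear_add[OF linear_fold])
    also have "norm \<dots> \<le> norm (fold m (g # l2) (q x)) + norm (fold m l2 (q (m g (p x))))"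
      by (rule norm_triangle_ineq)
    also have "norm (fold m (g # l2) (q x)) \<le> exp (b' * (dur l + dur (g # l2))) * (C * norm (q w) + real (length l) * R)"
      unfolding x_def using snoc g by (intro snoc.IH) auto
    also have "norm (fold m l2 (q (m g (p x)))) \<le> exp (b' * (dur l + dur (g # l2))) * R"
    proof -
      have "norm (fold m l2 (q (m g (p x)))) \<le> C * norm (q (m g (p x))) * exp (b' * dur l2)"
        using snoc.prems p(3) by (intro C) (auto simp: q_def)
      also have "norm (q (m g (p x))) \<le> \<kappa> * norm (m g (p x))" by (rule \<kappa>)
      also have "norm (m g (p x)) \<le> K * exp (c * d g) * norm (p x)" using g by (rule norm_m_le)
      also have "norm (p x) \<le> exp (b' * dur l) * norm (p w)"
        unfolding x_def using l by (rule quot)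
      also have "exp (c * d g) \<le> exp (b' * d g)"
        using rates(1) d_ge_1[OF g] by (simp add: mult_right_mono)
      finally have "norm (fold m l2 (q (m g (p x))))
          \<le> C * (\<kappa> * (K * exp (b' * d g) * (exp (b' * dur l) * norm (p w)))) * exp (b' * dur l2)"
        using C \<kappa> K_nonneg by (simp add: mult_left_mono mult_right_mono)
      also have "\<dots> = exp (b' * (dur l + dur (g # l2))) * R"
        by (simp add: R_def exp_add algebra_simps)
      finally show ?thesis .
    qed
    finally show ?case by (simp add: algebra_simps)
  qed
  define \<epsilon> where "\<epsilon> = b - b'"
  define H where "H = norm (p w) + C * norm (q w)"
  have \<epsilon>: "0 < \<epsilon>" using rates by (simp add: \<epsilon>_def)
  have H: "0 \<le> H" using C by (simp add: H_def)
  have "norm (fold m l w) \<le> (H + R / \<epsilon>) * exp (b * dur l)" if l: "l \<in> lists G" for l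
  proof -
    have dur: "real (length l) \<le> dur l" "0 \<le> dur l" using length_le_dur[OF l] by auto
    have "norm (fold m l w) \<le> norm (p (fold m l w)) + norm (q (fold m l w))"
      using norm_triangle_ineq[of "p (fold m l w)" "q (fold m l w)"] by (simp add: q_def)
    also have "\<dots> \<le> exp (b' * dur l) * (H + dur l * R)"
      using quot[OF l] main[OF l, of "[]"] mult_right_mono[OF dur(1) R]
        mult_left_mono[of "real (length l) * R" "dur l * R" "exp (b' * dur l)"]
      by (simp add: H_def algebra_simps)
    also have "H + dur l * R \<le> (H + R / \<epsilon>) * exp (\<epsilon> * dur l)"
    proof -
      have "1 \<le> exp (\<epsilon> * dur l)" using \<epsilon> dur by simp
      then have "H * 1 \<le> H * exp (\<epsilon> * dur l)" by (rule mult_left_mono[OF _ H])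
      moreover have "\<epsilon> * dur l \<le> exp (\<epsilon> * dur l)"
        using exp_ge_add_one_self[of "\<epsilon> * dur l"] by linarith
      then have "R / \<epsilon> * (\<epsilon> * dur l) \<le> R / \<epsilon> * exp (\<epsilon> * dur l)"
        using R \<epsilon> by (intro mult_left_mono) auto
      ultimately show ?thesis using \<epsilon> by (simp add: distrib_right mult.commute)
    qed
    also have "exp (b' * dur l) * ((H + R / \<epsilon>) * exp (\<epsilon> * dur l)) = (H + R / \<epsilon>) * exp (b * dur l)"
      by (simp add: \<epsilon>_def algebra_simps exp_add[symmetric])
    finally show ?thesis by simp
  qed
  then have "w \<in> tame b" unfolding tame_def by blast
  with w show False by simp
qed

text \<open>
  A word that expands one vector strictly expands its neighbours, so finitely many words expand all unit
  vectors of a complement of \<open>U\<close>. All other vectors outside \<open>U\<close> follow, since \<open>U\<close> is invariant and only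
  the component modulo \<open>U\<close> matters. The map \<open>p\<close> in the conclusion is a projection with kernel \<open>U\<close>.
\<close>

theorem finitely_many_expanding_words:
  assumes "c < a" and unbounded: "\<not> (\<exists>C. \<forall>l\<in>lists G. \<forall>x. norm (fold m l x) \<le> C * norm x * exp (a * dur l))"
  obtains p :: "'a \<Rightarrow> 'a" and b F where "linear p" "c < b" "finite F" "F \<subseteq> lists G" "\<exists>x. p x \<noteq> 0"
    "\<And>x. p x \<noteq> 0 \<Longrightarrow> \<exists>l\<in>F. exp (b * dur l) * norm (p x) < norm (p (fold m l x))"
proof -
  obtain b b' where b: "c < b'" "b' < b" "b < a" "tame b' = tame b"
    using stable_rate_exists[OF assms(1)] .
  obtain p where p: "linear p" "\<And>x. p x = 0 \<longleftrightarrow> x \<in> tame b" "\<And>x. x - p x \<in> tame b"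
    using projection_along_subspace[OF subspace_tame[of b]] by metis
  have "tame b \<noteq> UNIV"
  proof
    assume "tame b = UNIV"
    then have "tame a = UNIV" using tame_mono[of b a] b by auto
    with tame_uniform[of a] unbounded show False by (metis UNIV_I)
  qed
  then have nz: "\<exists>x. p x \<noteq> 0" using p(2) by blast
  have pp: "p (p x) = p x" for x
    using p(2)[of "x - p x"] p(3)[of x] by (simp add: linear_diff[OF p(1)])
  define S where "S = sphere 0 1 \<inter> {x. p x = x}"
  have cont: "continuous_on UNIV p" 
    by (rule linear_continuous_on[OF linear_conv_bounded_linear[THEN iffD1, OF p(1)]])
  have "compact S"
    unfolding S_def
    by (intro compact_Int_closed compact_sphere closed_Collect_eq cont continuous_on_id)
  define N where "N l = {x. exp (b' * dur l) * norm (p x) < norm (p (fold m l x))}" for l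
  have cont_fold: "continuous_on UNIV (\<lambda>x. p (fold m l x))" if "l \<in> lists G" for l
    using linear_compose[OF linear_fold[OF that] p(1)]
    by (intro linear_continuous_on) (simp add: o_def linear_conv_bounded_linear)
  have opn: "open (N l)" if "l \<in> lists G" for l
    unfolding N_def by (intro open_Collect_less continuous_intros cont cont_fold that)
  have cover: "S \<subseteq> (\<Union>l\<in>lists G. N l)"
  proof
    fix w assume "w \<in> S"
    then have "p w \<noteq> 0" by (auto simp: S_def)
    then have "w \<notin> tame b" using p(2) by blast
    from expanding_word_exists[OF _ b(2,4) this p] b(1)
    show "w \<in> (\<Union>l\<in>lists G. N l)" by (auto simp: N_def)
  qed
  obtain F where F: "F \<subseteq> lists G" "finite F" "S \<subseteq> (\<Union>l\<in>F. N l)"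
    using compactE_image[OF \<open>compact S\<close> opn cover] by blast
  have "\<exists>l\<in>F. exp (b' * dur l) * norm (p x) < norm (p (fold m l x))" if "p x \<noteq> 0" for x
  proof -
    define w where "w = p x /\<^sub>R norm (p x)"
    have "w \<in> S" using that by (simp add: S_def w_def linear_scale[OF p(1)] pp)
    then obtain l where l: "l \<in> F" "w \<in> N l" using F(3) by blast
    then have lG: "l \<in> lists G" using F(1) by blast
    have "fold m l (x - p x) \<in> tame b" using lG p(3) by (rule tame_fold)
    then have "p (fold m l (x - p x)) = 0" by (simp add: p(2))
    then have "p (fold m l x) = p (fold m l (p x))"
      by (simp add: linear_diff[OF linear_fold[OF lG]] linear_diff[OF p(1)])
    also have "p x = norm (p x) *\<^sub>R w" using that by (simp add: w_def)
    then have "p (fold m l (p x)) = norm (p x) *\<^sub>R p (fold m l w)"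
      by (metis linear_scale[OF linear_fold[OF lG]] linear_scale[OF p(1)])
    finally have 1: "norm (p (fold m l x)) = norm (p x) * norm (p (fold m l w))" by simp
    have "norm (p w) = 1" using \<open>w \<in> S\<close> by (simp add: S_def)
    then have "exp (b' * dur l) < norm (p (fold m l w))" using l(2) by (simp add: N_def)
    then have "exp (b' * dur l) * norm (p x) < norm (p (fold m l x))"
      unfolding 1 using that by (simp add: mult.commute)
    with l(1) show ?thesis by blast
  qed
  with that p(1) b(1) F nz show ?thesis by blast
qed

end

section \<open>Flows as products of steps\<close>

text \<open>
  Uniqueness on a set that may be half-open, as the intervals between switchings are, with one-sided
  derivatives at its left end: \<open>e\<^bsup>- t A\<^esup> y(t)\<close> has derivative zero.
\<close>

lemma linear_ode_unique:
  fixes A :: "real^'n^'n"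
  assumes "convex S" and y: "\<And>t. t \<in> S \<Longrightarrow> (y has_vector_derivative A *v y t) (at t within S)"
    and "s \<in> S" "t \<in> S"
  shows "y t = mexp A (t - s) *v y s"
proof -
  define E where "E t = exp (t *\<^sub>R (- linop_of A))" for t :: real
  have bb: "bounded_bilinear (linop_apply :: 'n linop \<Rightarrow> _)"
  proof
    show "linop_apply (F + G) x = linop_apply F x + linop_apply G x" for F G :: "'n linop" and x
      by transfer (rule blinfun.add_left)
    show "linop_apply (r *\<^sub>R F) x = r *\<^sub>R linop_apply F x" for r and F :: "'n linop" and x
      by transfer (rule blinfun.scaleR_left)
    show "\<exists>K. \<forall>(F :: 'n linop) x. norm (linop_apply F x) \<le> norm F * norm x * K"
      by (rule exI[of _ 1]) (simp add: norm_linop_apply_le)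
  qed (simp_all add: linear_add[OF linear_linop_apply] linear_scale[OF linear_linop_apply])
  have zero: "((\<lambda>t. linop_apply (E t) (y t)) has_vector_derivative 0) (at t within S)" if "t \<in> S" for t
  proof -
    have "((\<lambda>t. linop_apply (E t) (y t)) has_vector_derivative
        linop_apply (E t) (A *v y t) + linop_apply (E t * (- linop_of A)) (y t)) (at t within S)"
      unfolding E_def
      by (rule bounded_bilinear.has_vector_derivative[OF bb
            exp_scaleR_has_vector_derivative_right y[OF that]])
    also have "linop_apply (E t * (- linop_of A)) (y t) = - linop_apply (E t) (A *v y t)"
      using bounded_bilinear.minus_left[OF bb] by (simp add: linop_apply_mult)
    finally show ?thesis by simp
  qed
  obtain k where k: "\<And>t. t \<in> S \<Longrightarrow> linop_apply (E t) (y t) = k"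
    using has_vector_derivative_zero_constant[OF assms(1) zero] by blast
  have E: "linop_apply (E t) x = mexp A (- t) *v x" for t x
    by (simp add: E_def mexp_apply)
  have "y t = mexp A t *v (mexp A (- t) *v y t)"
    using mexp_inverse[of A "- t" "y t"] by simp
  also have "mexp A (- t) *v y t = mexp A (- s) *v y s"
    using k[OF assms(3)] k[OF assms(4)] unfolding E by simp
  also have "mexp A t *v (mexp A (- s) *v y s) = mexp A (t - s) *v y s"
    by (simp only: matrix_vector_mul_assoc mexp_add[symmetric]) simp
  finally show ?thesis .
qed

lemma mexp_shifted_has_vector_derivative:
  "((\<lambda>t. mexp A (t - s) *v x) has_vector_derivative A *v (mexp A (t - s) *v x)) (at t within T)"
proof -
  have "mexp A (t - s) *v x = mexp A t *v (mexp A (- s) *v x)" for t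
    by (simp only: matrix_vector_mul_assoc mexp_add[symmetric]) simp
  then show ?thesis using mexp_has_vector_derivative by simp
qed

text \<open>
  A mode together with the time for which it is active before it jumps.
\<close>

type_synonym 'n step = "'n mode \<times> real"

definition step_map :: "('n::finite) step \<Rightarrow> real^'n \<Rightarrow> real^'n" where
  "step_map g x = snd (fst g) *v (mexp (fst (fst g)) (snd g) *v x)"

definition duration :: "('n::finite) step list \<Rightarrow> real" where
  "duration l = sum_list (map snd l)"

lemma duration_simps [simp]:
  "duration [] = 0" "duration (g # l) = snd g + duration l" "duration (l @ l') = duration l + duration l'"
  by (simp_all add: duration_def)

definition steps :: "('n::finite) mode set \<Rightarrow> real \<Rightarrow> 'n step set" where
  "steps \<Z> \<tau> = {(z, s). z \<in> \<Z> \<and> 0 < s \<and> \<tau> \<le> s}"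

definition stime :: "('n::finite) signal \<Rightarrow> nat \<Rightarrow> real" where
  "stime Z k = real_of_ereal (switch_time Z k)"

definition signal_steps :: "('n::finite) signal \<Rightarrow> nat \<Rightarrow> 'n step list" where
  "signal_steps Z k = map (\<lambda>j. (mode_at Z j, stime Z (Suc j) - stime Z j)) [0..<k]"

lemma signal_steps_simps [simp]:
  "signal_steps Z 0 = []"
  "signal_steps Z (Suc k) = signal_steps Z k @ [(mode_at Z k, stime Z (Suc k) - stime Z k)]"
  by (simp_all add: signal_steps_def)

lemma stime_0 [simp]: "stime Z 0 = 0"
  by (simp add: stime_def switch_time_def)

lemma duration_signal_steps: "duration (signal_steps Z k) = stime Z k"
  by (induction k) simp_all

lemma linear_step_map: "linear (step_map g)"
proof -
  have "step_map g = (\<lambda>x. (snd (fst g) ** mexp (fst (fst g)) (snd g)) *v x)"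
    by (simp add: step_map_def fun_eq_iff matrix_vector_mul_assoc)
  then show ?thesis by simp
qed

lemma linear_fold_step_map: "linear (fold step_map l)"
proof (induction l)
  case (Cons g l)
  show ?case unfolding fold.simps by (rule linear_compose[OF linear_step_map Cons.IH])
qed (simp only: fold.simps linear_id)

lemma Theta_0 [simp]: "0 \<in> Theta Z"
  by (simp add: Theta_def)

lemma Theta_Suc_iff: "Suc k \<in> Theta Z \<longleftrightarrow> Suc k \<in> Theta_star Z"
  by (simp add: Theta_def)

lemma Theta_SucD: "Suc k \<in> Theta Z \<Longrightarrow> k \<in> Theta Z"
  by (cases k) (auto simp: Theta_def Theta_star_def elim!: order_trans[rotated])

lemma switch_time_eq: "k \<in> Theta Z \<Longrightarrow> switch_time Z k = ereal (stime Z k)"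
  by (auto simp: stime_def switch_time_def Theta_def zero_ereal_def)

lemma stime_eq_swt: "k \<in> Theta_star Z \<Longrightarrow> stime Z k = swt Z k"
  by (auto simp: stime_def switch_time_def Theta_star_def)

lemma mode_interval_iff:
  assumes "k \<in> Theta Z"
  shows "t \<in> mode_interval Z k \<longleftrightarrow> stime Z k \<le> t \<and> (Suc k \<in> Theta Z \<longrightarrow> t < stime Z (Suc k))"
proof (cases "Suc k \<in> Theta Z")
  case True
  then show ?thesis using assms by (auto simp: mode_interval_def switch_time_eq)
next
  case False
  then have "switch_time Z (Suc k) = \<infinity>" by (simp add: switch_time_def Theta_Suc_iff)
  with False show ?thesis using assms by (auto simp: mode_interval_def switch_time_eq)
qed

lemma convex_mode_interval:
  assumes "k \<in> Theta Z"
  shows "convex (mode_interval Z k)"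
  unfolding convex_contains_segment
  by (auto simp: mode_interval_iff[OF assms] closed_segment_eq_real_ivl split: if_splits)

context
  fixes \<Z> :: "('n::finite) mode set" and Z :: "'n signal"
  assumes Z: "Z \<in> signals \<Z>"
begin

lemma stime_less_Suc: "Suc k \<in> Theta Z \<Longrightarrow> stime Z k < stime Z (Suc k)"
  using Z Theta_SucD[of k Z] switch_time_eq[of k Z] switch_time_eq[of "Suc k" Z]
  unfolding signals_def by auto

lemma stime_strict_mono: "j < k \<Longrightarrow> k \<in> Theta Z \<Longrightarrow> stime Z j < stime Z k"
proof (induction k)
  case (Suc k)
  then show ?case using stime_less_Suc[of k] Theta_SucD[of k Z] by (cases "j = k") auto
qed simp

lemma stime_nonneg: "k \<in> Theta Z \<Longrightarrow> 0 \<le> stime Z k"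
  using stime_strict_mono[of 0 k] by (cases k) auto

lemma left_end_in_mode_interval: "k \<in> Theta Z \<Longrightarrow> stime Z k \<in> mode_interval Z k"
  using stime_less_Suc by (auto simp: mode_interval_iff)

lemma mode_interval_unique:
  assumes "j \<in> Theta Z" "k \<in> Theta Z" "t \<in> mode_interval Z j" "t \<in> mode_interval Z k"
  shows "j = k"
proof -
  have False if "i < l" "i \<in> Theta Z" "l \<in> Theta Z" "t \<in> mode_interval Z i" "t \<in> mode_interval Z l" for i l
  proof -
    have SucT: "Suc i \<in> Theta Z"
      using that(1,3) by (induction l) (metis not_less0 less_SucE Theta_SucD)+
    have "stime Z (Suc i) \<le> stime Z l"
      using stime_strict_mono[of "Suc i" l] that by (cases "Suc i = l") auto
    then show False using that SucT by (auto simp: mode_interval_iff)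
  qed
  with assms show ?thesis by (metis linorder_neqE_nat)
qed

text \<open>
  Infinitely many switchings in a compact time interval would accumulate, so there is a last one up to time \<open>t\<close>.
\<close>

lemma mode_interval_exists:
  assumes "0 \<le> t"
  obtains k where "k \<in> Theta Z" "t \<in> mode_interval Z k"
proof -
  define K where "K = {k \<in> Theta Z. stime Z k \<le> t}"
  have "finite (stime Z ` (K - {0}))"
  proof (rule ccontr)
    assume inf: "infinite (stime Z ` (K - {0}))"
    have sub: "stime Z ` (K - {0}) \<subseteq> swt Z ` Theta_star Z"
      by (auto simp: K_def Theta_def stime_eq_swt)
    have "stime Z ` (K - {0}) \<subseteq> {0..t}" using stime_nonneg by (auto simp: K_def)
    then have "\<exists>a. a islimpt (stime Z ` (K - {0}))"
      using inf compact_eq_Bolzano_Weierstrass[of "{0..t}"] by (auto simp: compact_Icc)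
    then show False using Z islimpt_subset[OF _ sub] unfolding signals_def by blast
  qed
  moreover have "inj_on (stime Z) (K - {0})"
    using stime_strict_mono by (auto simp: inj_on_def K_def) (metis linorder_neqE_nat less_irrefl)
  ultimately have "finite (K - {0})" by (rule finite_imageD)
  then have fin: "finite K" by simp
  have "0 \<in> K" using assms by (simp add: K_def)
  then have max: "Max K \<in> K" "Suc (Max K) \<notin> K"
    using Max_in[OF fin] Max_ge[OF fin, of "Suc (Max K)"] by (blast, meson not_less_eq_eq order_refl)
  then have "t \<in> mode_interval Z (Max K)"
    by (subst mode_interval_iff) (auto simp: K_def)
  with max that show ?thesis by (auto simp: K_def)
qed

lemma solution_unique:
  assumes x: "is_solution Z x" and "k \<in> Theta Z" "t \<in> mode_interval Z k"
  shows "x t = mexp (fst (mode_at Z k)) (t - stime Z k) *v fold step_map (signal_steps Z k) (x 0)"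
proof -
  have on_interval: "x t = mexp (fst (mode_at Z k)) (t - stime Z k) *v x (stime Z k)"
    if "k \<in> Theta Z" "t \<in> mode_interval Z k" for k t
    using x that
    by (intro linear_ode_unique[OF convex_mode_interval[OF that(1)]] left_end_in_mode_interval)
      (auto simp: is_solution_def)
  have "x (stime Z k) = fold step_map (signal_steps Z k) (x 0)" if "k \<in> Theta Z" for k
    using that
  proof (induction k)
    case (Suc k)
    note kT = Theta_SucD[OF Suc.prems]
    define A where "A = fst (mode_at Z k)"
    define y where "y t = mexp A (t - stime Z k) *v x (stime Z k)" for t
    obtain l where l: "(x \<longlongrightarrow> l) (at_left (stime Z (Suc k)))"
      "x (stime Z (Suc k)) = snd (mode_at Z k) *v l"
      using x Suc.prems unfolding is_solution_def Theta_Suc_iff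
      by (metis diff_Suc_1 stime_eq_swt)
    have "\<forall>\<^sub>F t in at_left (stime Z (Suc k)). x t = y t"
      using eventually_at_left_real[OF stime_less_Suc[OF Suc.prems]]
    proof eventually_elim
      case (elim t)
      then show ?case unfolding y_def A_def using kT
        by (intro on_interval) (auto simp: mode_interval_iff)
    qed
    with l(1) have "(y \<longlongrightarrow> l) (at_left (stime Z (Suc k)))"
      by (simp add: tendsto_cong)
    moreover have "(y \<longlongrightarrow> y (stime Z (Suc k))) (at_left (stime Z (Suc k)))"
      using has_vector_derivative_continuous[OF mexp_shifted_has_vector_derivative[of A _ _ _ UNIV]]
      unfolding y_def continuous_within by (rule tendsto_within_subset) simp
    ultimately have "l = y (stime Z (Suc k))"
      by (rule tendsto_unique[OF trivial_limit_at_left_real])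
    with l(2) Suc.IH[OF kT] show ?case by (simp add: y_def A_def step_map_def)
  qed simp
  with on_interval[OF assms(2,3)] assms(2) show ?thesis by simp
qed

lemma solution_exists: "\<exists>x. is_solution Z x \<and> x 0 = x0"
proof -
  define idx where "idx t = (SOME k. k \<in> Theta Z \<and> t \<in> mode_interval Z k)" for t
  have idx: "idx t = k" if "k \<in> Theta Z" "t \<in> mode_interval Z k" for k t
    unfolding idx_def using that mode_interval_unique by (intro some_equality) auto
  define w where "w k t = mexp (fst (mode_at Z k)) (t - stime Z k) *v fold step_map (signal_steps Z k) x0" for k t
  define x where "x t = w (idx t) t" for t
  have x: "x t = w k t" if "k \<in> Theta Z" "t \<in> mode_interval Z k" for k t
    by (simp add: x_def idx[OF that])
  have w': "(w k has_vector_derivative fst (mode_at Z k) *v w k t) (at t within S)" for k t S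
    unfolding w_def by (rule mexp_shifted_has_vector_derivative)
  have "is_solution Z x"
    unfolding is_solution_def
  proof (intro conjI ballI)
    fix k t assume k: "k \<in> Theta Z" "t \<in> mode_interval Z k"
    show "(x has_vector_derivative fst (mode_at Z k) *v x t) (at t within mode_interval Z k)"
      unfolding x[OF k] by (rule has_vector_derivative_transform[OF k(2) x[OF k(1)] w'])
  next
    fix k assume k: "k \<in> Theta_star Z"
    then obtain j where j: "k = Suc j" by (cases k) (auto simp: Theta_star_def)
    have kT: "Suc j \<in> Theta Z" using k by (simp add: j Theta_def)
    note jT = Theta_SucD[OF kT]
    have "\<forall>\<^sub>F t in at_left (stime Z k). x t = w j t"
      using eventually_at_left_real[OF stime_less_Suc[OF kT]] unfolding j
    proof eventually_elim
      case (elim t)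
      then show ?case using jT by (intro x) (auto simp: mode_interval_iff)
    qed
    moreover have "(w j \<longlongrightarrow> w j (stime Z k)) (at_left (stime Z k))"
      using has_vector_derivative_continuous[OF w'[of j "stime Z k" UNIV]]
      unfolding continuous_within by (rule tendsto_within_subset) simp
    ultimately have "(x \<longlongrightarrow> w j (stime Z k)) (at_left (swt Z k))"
      using k by (simp add: tendsto_cong stime_eq_swt)
    moreover have "x (swt Z k) = snd (mode_at Z (k - 1)) *v w j (stime Z k)"
      using x[OF kT left_end_in_mode_interval[OF kT]] k
      by (simp add: j w_def step_map_def stime_eq_swt[symmetric])
    ultimately show "\<exists>l. (x \<longlongrightarrow> l) (at_left (swt Z k)) \<and> x (swt Z k) = snd (mode_at Z (k - 1)) *v l"
      by blast
  qed
  moreover have "x 0 = x0"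
    using x[of 0 0] left_end_in_mode_interval[of 0] by (simp add: w_def)
  ultimately show ?thesis by blast
qed

text \<open>
  The flow matrix is defined by a property of all solutions. Uniqueness of solutions shows that the product
  of steps has this property, and a solution for every initial value makes it the only such matrix.
\<close>

lemma flow_matrix_eq:
  assumes "k \<in> Theta Z" "t \<in> mode_interval Z k"
  shows "flow_matrix Z t *v x0 = mexp (fst (mode_at Z k)) (t - stime Z k) *v fold step_map (signal_steps Z k) x0"
proof -
  define M where "M = mexp (fst (mode_at Z k)) (t - stime Z k) ** matrix (fold step_map (signal_steps Z k))"
  have M: "M *v x = mexp (fst (mode_at Z k)) (t - stime Z k) *v fold step_map (signal_steps Z k) x" for x
    by (simp add: M_def matrix_vector_mul_assoc[symmetric] matrix_works linear_fold_step_map)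
  have "flow_matrix Z t = M"
    unfolding flow_matrix_def
  proof (rule the_equality)
    show "\<forall>x. is_solution Z x \<longrightarrow> x t = M *v x 0"
      using solution_unique[OF _ assms] by (simp add: M)
    fix N assume N: "\<forall>x. is_solution Z x \<longrightarrow> x t = N *v x 0"
    have "N *v v = M *v v" for v
    proof -
      obtain x where "is_solution Z x" "x 0 = v" using solution_exists by blast
      with N solution_unique[OF _ assms] show ?thesis by (metis M)
    qed
    then show "N = M" by (simp add: matrix_eq)
  qed
  then show ?thesis by (simp add: M)
qed

end

lemma flow_matrix_factorization:
  assumes Z: "Z \<in> dwell_signals \<Z> \<tau>" and "0 \<le> t"
  obtains l z s where "l \<in> lists (steps \<Z> \<tau>)" "z \<in> \<Z>" "0 \<le> s" "t = duration l + s"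
    "\<And>x. flow_matrix Z t *v x = mexp (fst z) s *v fold step_map l x"
proof -
  have sig: "Z \<in> signals \<Z>" using Z by (simp add: dwell_signals_def)
  obtain k where k: "k \<in> Theta Z" "t \<in> mode_interval Z k"
    using mode_interval_exists[OF sig assms(2)] .
  have val: "mode_at Z j \<in> \<Z>" if "j \<in> Theta Z" for j
    using sig stime_nonneg[OF sig that] by (simp add: signals_def mode_at_def stime_def)
  have "signal_steps Z j \<in> lists (steps \<Z> \<tau>)" if "j \<in> Theta Z" for j
    using that
  proof (induction j)
    case (Suc j)
    note jT = Theta_SucD[OF Suc.prems]
    have "switch_time Z j + ereal \<tau> \<le> switch_time Z (Suc j)"
      using Z jT by (simp add: dwell_signals_def)
    then have "\<tau> \<le> stime Z (Suc j) - stime Z j"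
      by (simp add: switch_time_eq jT Suc.prems)
    then show ?case
      using Suc jT val[OF jT] stime_less_Suc[OF sig Suc.prems] by (auto simp: steps_def)
  qed simp
  moreover have "0 \<le> t - stime Z k" using k by (simp add: mode_interval_iff)
  ultimately show ?thesis
    using that[of "signal_steps Z k" "mode_at Z k" "t - stime Z k"] k val flow_matrix_eq[OF sig k]
    by (simp add: duration_signal_steps)
qed

section \<open>Signals built from sequences of steps\<close>

text \<open>
  The durations are bounded away from zero, which keeps the switching times from accumulating and makes them
  exhaust the time axis.
\<close>

lemma signal_of_steps:
  fixes \<sigma> :: "nat \<Rightarrow> ('n::finite) step"
  assumes \<sigma>: "\<And>k. \<sigma> k \<in> steps \<Z> \<tau>" and \<eta>: "0 < \<eta>" "\<And>k. \<eta> \<le> snd (\<sigma> k)" and "0 \<le> \<tau>"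
  obtains Z where "Z \<in> dwell_signals \<Z> \<tau>"
    "\<And>k s x. 0 \<le> s \<Longrightarrow> s < snd (\<sigma> k) \<Longrightarrow>
      flow_matrix Z (duration (map \<sigma> [0..<k]) + s) *v x =
      mexp (fst (fst (\<sigma> k))) s *v fold step_map (map \<sigma> [0..<k]) x"
    "\<And>t. 0 \<le> t \<Longrightarrow> \<exists>k s. 0 \<le> s \<and> s < snd (\<sigma> k) \<and> t = duration (map \<sigma> [0..<k]) + s"
proof -
  define T where "T k = duration (map \<sigma> [0..<k])" for k
  have T0 [simp]: "T 0 = 0" and T_Suc: "T (Suc k) = T k + snd (\<sigma> k)" for k
    by (simp_all add: T_def)
  have T_less: "T k < T (Suc k)" for k using \<eta>(1) \<eta>(2)[of k] by (simp add: T_Suc)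
  then have T_mono: "strict_mono T" by (simp add: strict_mono_Suc_iff)
  have T_ge: "real k * \<eta> \<le> T k" for k
  proof (induction k)
    case (Suc k)
    then show ?case using \<eta>(2)[of k] by (simp add: T_Suc distrib_right)
  qed simp
  define idx where "idx t = (THE k. T k \<le> t \<and> t < T (Suc k))" for t
  have uniq: "j = k" if "T j \<le> t" "t < T (Suc j)" "T k \<le> t" "t < T (Suc k)" for j k t
  proof -
    have "T j < T (Suc k)" "T k < T (Suc j)" using that by auto
    then show ?thesis 
      using strict_mono_less[OF T_mono, of j "Suc k"] strict_mono_less[OF T_mono, of k "Suc j"] by simp
  qed
  have idx: "idx t = k" if "T k \<le> t" "t < T (Suc k)" for k t
    unfolding idx_def
  proof (rule the_equality)
    show "T k \<le> t \<and> t < T (Suc k)" using that by simp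
    show "j = k" if "T j \<le> t \<and> t < T (Suc j)" for j
      using that \<open>T k \<le> t\<close> \<open>t < T (Suc k)\<close> by (intro uniq) auto
  qed
  define Z :: "'n signal" where "Z = \<lparr>val = \<lambda>t. fst (\<sigma> (idx t)), nsw = \<infinity>, swt = T\<rparr>"
  have sel [simp]: "val Z t = fst (\<sigma> (idx t))" "nsw Z = \<infinity>" "swt Z = T" for t by (simp_all add: Z_def)
  have Ts: "Theta_star Z = {1..}" by (auto simp: Theta_star_def)
  have Th: "k \<in> Theta Z" for k by (cases k) (simp_all add: Theta_def Ts)
  have st: "switch_time Z k = ereal (T k)" for k
    by (cases k) (auto simp: switch_time_def Ts zero_ereal_def)
  have mi: "mode_interval Z k = {T k..<T (Suc k)}" for k by (auto simp: mode_interval_def st)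
  have ma: "mode_at Z k = fst (\<sigma> k)" for k
    by (simp add: mode_at_def st idx[OF order_refl T_less])
  have \<sigma>': "fst (\<sigma> k) \<in> \<Z>" "\<tau> \<le> snd (\<sigma> k)" for k using \<sigma>[of k] by (auto simp: steps_def)
  have nolim: "\<not> a islimpt (swt Z ` Theta_star Z)" for a
  proof
    assume "a islimpt (swt Z ` Theta_star Z)"
    then have inf: "infinite (swt Z ` Theta_star Z \<inter> {..<a + 1})"
      unfolding islimpt_eq_acc_point by (metis Int_commute lessThan_iff less_add_one open_lessThan)
    have "swt Z ` Theta_star Z \<inter> {..<a + 1} \<subseteq> T ` {k. real k \<le> (a + 1) / \<eta>}"
    proof safe
      fix k assume "swt Z k < a + 1"
      then have "real k * \<eta> \<le> a + 1" using T_ge[of k] by simp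
      then have "real k \<le> (a + 1) / \<eta>" using \<eta> by (simp add: field_simps)
      then show "swt Z k \<in> T ` {k. real k \<le> (a + 1) / \<eta>}" by auto
    qed
    moreover have "{k. real k \<le> (a + 1) / \<eta>} \<subseteq> {..nat \<lfloor>(a + 1) / \<eta>\<rfloor>}"
      by (auto simp: le_nat_floor)
    then have "finite {k. real k \<le> (a + 1) / \<eta>}" by (rule finite_subset) simp
    ultimately show False using inf by (meson finite_imageI finite_subset)
  qed
  have "\<forall>t\<in>mode_interval Z k. val Z t = fst (\<sigma> k)" for k
    using idx[of k] by (auto simp: mi)
  then have "val Z constant_on mode_interval Z k" for k
    unfolding constant_on_def by blast
  then have "Z \<in> signals \<Z>"
    unfolding signals_def using nolim T_less \<sigma>' by (simp add: st)
  moreover have "ereal (T k) + ereal \<tau> \<le> ereal (T (Suc k))" for k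
    using \<sigma>'(2)[of k] by (simp add: T_Suc)
  ultimately have Zd: "Z \<in> dwell_signals \<Z> \<tau>"
    unfolding dwell_signals_def by (auto simp: st)
  have stm: "stime Z k = T k" for k by (simp add: stime_def st)
  have ss: "signal_steps Z k = map \<sigma> [0..<k]" for k
    by (simp add: signal_steps_def ma stm T_Suc)
  show ?thesis
  proof (rule that[OF Zd])
    fix k s x assume s: "0 \<le> s" "s < snd (\<sigma> k)"
    have "flow_matrix Z (T k + s) *v x =
        mexp (fst (mode_at Z k)) (T k + s - stime Z k) *v fold step_map (signal_steps Z k) x"
      using s by (intro flow_matrix_eq[OF \<open>Z \<in> signals \<Z>\<close> Th]) (simp add: mi T_Suc)
    then show "flow_matrix Z (duration (map \<sigma> [0..<k]) + s) *v x =
      mexp (fst (fst (\<sigma> k))) s *v fold step_map (map \<sigma> [0..<k]) x"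
      by (simp add: ma stm ss T_def)
  next
    fix t :: real assume "0 \<le> t"
    then obtain k where "t \<in> mode_interval Z k"
      using mode_interval_exists[OF \<open>Z \<in> signals \<Z>\<close>] by metis
    then have "0 \<le> t - T k \<and> t - T k < snd (\<sigma> k) \<and> t = duration (map \<sigma> [0..<k]) + (t - T k)"
      by (simp add: mi T_Suc T_def)
    then show "\<exists>k s. 0 \<le> s \<and> s < snd (\<sigma> k) \<and> t = duration (map \<sigma> [0..<k]) + s" by blast
  qed
qed

lemma constant_signal:
  fixes z :: "('n::finite) mode"
  assumes "z \<in> \<Z>"
  obtains Z where "Z \<in> dwell_signals \<Z> \<tau>" "\<And>t x. 0 \<le> t \<Longrightarrow> flow_matrix Z t *v x = mexp (fst z) t *v x"
proof -
  define Z :: "'n signal" where "Z = \<lparr>val = \<lambda>t. z, nsw = 0, swt = \<lambda>k. 0\<rparr>"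
  have Ts: "Theta_star Z = {}" by (auto simp: Theta_star_def Z_def zero_enat_def)
  then have Th: "Theta Z = {0}" by (auto simp: Theta_def)
  have st: "switch_time Z 0 = 0" "switch_time Z (Suc 0) = \<infinity>" by (auto simp: switch_time_def Ts)
  have val: "val Z t = z" for t by (simp add: Z_def)
  have sig: "Z \<in> signals \<Z>"
    unfolding signals_def using assms by (auto simp: Th Ts st constant_on_def val)
  moreover have "Z \<in> dwell_signals \<Z> \<tau>"
    unfolding dwell_signals_def using sig by (auto simp: Th st)
  moreover have "flow_matrix Z t *v x = mexp (fst z) t *v x" if "0 \<le> t" for t x
    using flow_matrix_eq[OF sig, of 0 t x] that
    by (simp add: mode_interval_iff Th) (simp add: mode_at_def val)
  ultimately show ?thesis using that by blast
qed

text \<open>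
  After the word the mode \<open>z\<close> is repeated for ever, each time long enough that the first repetition still
  runs at time \<open>s\<close>.
\<close>

lemma signal_realizing_word:
  fixes l :: "('n::finite) step list"
  assumes l: "l \<in> lists (steps \<Z> \<tau>)" and z: "z \<in> \<Z>" and "0 \<le> s" "0 \<le> \<tau>"
  obtains Z where "Z \<in> dwell_signals \<Z> \<tau>"
    "\<And>x. flow_matrix Z (duration l + s) *v x = mexp (fst z) s *v fold step_map l x"
proof -
  define \<sigma> where "\<sigma> k = (if k < length l then l ! k else (z, s + \<tau> + 1))" for k
  have \<sigma>: "\<sigma> k \<in> steps \<Z> \<tau>" for k
    using assms l[unfolded in_lists_conv_set] by (auto simp: \<sigma>_def steps_def)
  define I where "I = insert (s + \<tau> + 1) (snd ` set l)"
  have I: "finite I" "I \<noteq> {}" "\<And>r. r \<in> I \<Longrightarrow> 0 < r"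
    using assms l by (auto simp: I_def steps_def)
  have "snd (\<sigma> k) \<in> I" for k by (auto simp: \<sigma>_def I_def)
  then have 1: "Min I \<le> snd (\<sigma> k)" for k using I(1) by simp
  have 2: "0 < Min I" using I by simp
  have 3: "map \<sigma> [0..<length l] = l"
    by (rule nth_equalityI) (simp_all add: \<sigma>_def)
  show ?thesis
  proof (rule signal_of_steps[of \<sigma> \<Z> \<tau> "Min I", OF \<sigma> 2 1 assms(4)])
    fix Z
    assume Z: "Z \<in> dwell_signals \<Z> \<tau>"
      and flow: "\<And>k s x. 0 \<le> s \<Longrightarrow> s < snd (\<sigma> k) \<Longrightarrow>
        flow_matrix Z (duration (map \<sigma> [0..<k]) + s) *v x =
        mexp (fst (fst (\<sigma> k))) s *v fold step_map (map \<sigma> [0..<k]) x"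
    have "flow_matrix Z (duration l + s) *v x = mexp (fst z) s *v fold step_map l x" for x
      using flow[of s "length l" x, unfolded 3] assms(3,4) by (simp add: \<sigma>_def)
    with Z show ?thesis by (rule that)
  qed
qed

section \<open>The maximal Lyapunov exponent and exponential bounds\<close>

lemma op_norm_le_norm: "op_norm M \<le> norm M" for M :: "real^'n^'n"
proof (rule op_norm_le)
  fix x
  have "norm (M *v x) = L2_set (\<lambda>i. \<bar>(M *v x) $ i\<bar>) UNIV" by (simp add: norm_vec_def)
  also have "\<dots> \<le> L2_set (\<lambda>i. norm (M $ i) * norm x) UNIV"
    by (intro L2_set_mono) (simp_all add: matrix_vector_mul_component Cauchy_Schwarz_ineq2)
  also have "\<dots> = norm M * norm x"
    by (simp add: norm_vec_def L2_set_left_distrib)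
  finally show "norm (M *v x) \<le> norm M * norm x" .
qed

lemma bounded_modes_op_norm:
  fixes \<Z> :: "('n::finite) mode set"
  assumes "bounded \<Z>"
  obtains M where "0 \<le> M" "\<And>z. z \<in> \<Z> \<Longrightarrow> op_norm (fst z) \<le> M" "\<And>z. z \<in> \<Z> \<Longrightarrow> op_norm (snd z) \<le> M"
proof -
  obtain M where M: "M > 0" "\<And>z. z \<in> \<Z> \<Longrightarrow> norm z \<le> M" using assms by (auto simp: bounded_pos)
  have "op_norm (fst z) \<le> M" "op_norm (snd z) \<le> M" if "z \<in> \<Z>" for z
    using M(2)[OF that] op_norm_le_norm[of "fst z"] op_norm_le_norm[of "snd z"]
      norm_fst_le[of "fst z" "snd z"] norm_snd_le[of "snd z" "fst z"] by auto
  with M(1) show ?thesis by (intro that[of M]) auto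
qed

lemma norm_mexp_le:
  assumes "op_norm A \<le> M" "\<bar>t\<bar> \<le> s" "0 \<le> M"
  shows "norm (mexp A t *v x) \<le> exp (M * s) * norm x"
proof -
  have "\<bar>t\<bar> * op_norm A \<le> s * M" using assms op_norm_nonneg[of A] by (intro mult_mono) auto
  then have "op_norm (mexp A t) \<le> exp (M * s)"
    using op_norm_mexp_le[of A t] by (simp add: mult.commute order_trans)
  then show ?thesis
    using norm_matrix_vector_mult_le[of "mexp A t" x] by (meson mult_right_mono norm_ge_zero order_trans)
qed

lemma lin_over_t_tendsto: "((\<lambda>t. ereal ((1 / t) * (b + a * t))) \<longlongrightarrow> ereal a) at_top"
proof -
  have "((\<lambda>t::real. b / t) \<longlongrightarrow> 0) at_top"
    using tendsto_mult_right_zero[OF tendsto_inverse_0_at_top[OF filterlim_ident], of b]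
    by (simp add: divide_inverse)
  then have "((\<lambda>t. b / t + a) \<longlongrightarrow> a) at_top"
    using tendsto_add[OF _ tendsto_const, of _ 0 at_top a] by simp
  moreover have "\<forall>\<^sub>F t in at_top. b / t + a = (1 / t) * (b + a * t)"
    using eventually_gt_at_top[of "0::real"] by eventually_elim (simp add: field_simps)
  ultimately have "((\<lambda>t. (1 / t) * (b + a * t)) \<longlongrightarrow> a) at_top"
    by (rule Lim_transform_eventually)
  then show ?thesis by simp
qed

lemma max_lyapunov_le:
  fixes \<Z> :: "('n::finite) mode set"
  assumes "0 < K" and bound: "\<And>t Z. 0 \<le> t \<Longrightarrow> Z \<in> dwell_signals \<Z> \<tau> \<Longrightarrow> op_norm (flow_matrix Z t) \<le> K * exp (a * t)"
  shows "max_lyapunov \<Z> \<tau> \<le> ereal a"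
proof -
  have "max_lyapunov \<Z> \<tau> \<le> Limsup at_top (\<lambda>t. ereal ((1 / t) * (ln K + a * t)))"
    unfolding max_lyapunov_def
  proof (rule Limsup_mono)
    show "\<forall>\<^sub>F t in at_top. ereal (1 / t) * (SUP Z\<in>dwell_signals \<Z> \<tau>. log_ext (op_norm (flow_matrix Z t)))
        \<le> ereal ((1 / t) * (ln K + a * t))"
      using eventually_gt_at_top[of "0::real"]
    proof eventually_elim
      case (elim t)
      have "(SUP Z\<in>dwell_signals \<Z> \<tau>. log_ext (op_norm (flow_matrix Z t))) \<le> ereal (ln K + a * t)"
      proof (rule SUP_least)
        fix Z assume Z: "Z \<in> dwell_signals \<Z> \<tau>"
        show "log_ext (op_norm (flow_matrix Z t)) \<le> ereal (ln K + a * t)"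
        proof (cases "op_norm (flow_matrix Z t) = 0")
          case False
          then have pos: "0 < op_norm (flow_matrix Z t)"
            using op_norm_nonneg[of "flow_matrix Z t"] by linarith
          then have "ln (op_norm (flow_matrix Z t)) \<le> ln (K * exp (a * t))"
            using bound[OF _ Z, of t] elim \<open>0 < K\<close> by (subst ln_le_cancel_iff) auto
          also have "\<dots> = ln K + a * t" using \<open>0 < K\<close> by (simp add: ln_mult)
          finally show ?thesis using False by (simp add: log_ext_def)
        qed (simp add: log_ext_def)
      qed
      then have "ereal (1 / t) * (SUP Z\<in>dwell_signals \<Z> \<tau>. log_ext (op_norm (flow_matrix Z t)))
          \<le> ereal (1 / t) * ereal (ln K + a * t)"
        using elim by (intro ereal_mult_left_mono) auto
      then show ?case by simp
    qed
  qed
  also have "\<dots> = ereal a"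
    by (rule lim_imp_Limsup[OF trivial_limit_at_top_linorder lin_over_t_tendsto])
  finally show ?thesis .
qed

lemma max_lyapunov_ge:
  fixes \<Z> :: "('n::finite) mode set"
  assumes "0 < K" and Z: "Z \<in> dwell_signals \<Z> \<tau>"
    and bound: "\<And>t. 0 \<le> t \<Longrightarrow> K * exp (a * t) \<le> op_norm (flow_matrix Z t)"
  shows "ereal a \<le> max_lyapunov \<Z> \<tau>"
proof -
  have "ereal a = Limsup at_top (\<lambda>t. ereal ((1 / t) * (ln K + a * t)))"
    by (rule lim_imp_Limsup[OF trivial_limit_at_top_linorder lin_over_t_tendsto, symmetric])
  also have "\<dots> \<le> max_lyapunov \<Z> \<tau>"
    unfolding max_lyapunov_def
  proof (rule Limsup_mono)
    show "\<forall>\<^sub>F t in at_top. ereal ((1 / t) * (ln K + a * t))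
        \<le> ereal (1 / t) * (SUP Z\<in>dwell_signals \<Z> \<tau>. log_ext (op_norm (flow_matrix Z t)))"
      using eventually_gt_at_top[of "0::real"]
    proof eventually_elim
      case (elim t)
      have pos: "0 < K * exp (a * t)" using \<open>0 < K\<close> by simp
      have "ln K + a * t = ln (K * exp (a * t))" using \<open>0 < K\<close> by (simp add: ln_mult)
      also have "\<dots> \<le> ln (op_norm (flow_matrix Z t))"
        using bound[of t] elim pos by (subst ln_le_cancel_iff) auto
      finally have "ereal (ln K + a * t) \<le> log_ext (op_norm (flow_matrix Z t))"
        using bound[of t] elim pos by (auto simp: log_ext_def)
      also have "\<dots> \<le> (SUP Z\<in>dwell_signals \<Z> \<tau>. log_ext (op_norm (flow_matrix Z t)))"
        using Z by (rule SUP_upper)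
      finally have "ereal (1 / t) * ereal (ln K + a * t)
          \<le> ereal (1 / t) * (SUP Z\<in>dwell_signals \<Z> \<tau>. log_ext (op_norm (flow_matrix Z t)))"
        using elim by (intro ereal_mult_left_mono) auto
      then show ?case by simp
    qed
  qed
  finally show ?thesis .
qed

lemma max_lyapunov_lessD:
  fixes \<Z> :: "('n::finite) mode set"
  assumes "max_lyapunov \<Z> \<tau> < ereal a"
  obtains T where "0 < T"
    "\<And>t Z. T \<le> t \<Longrightarrow> Z \<in> dwell_signals \<Z> \<tau> \<Longrightarrow> op_norm (flow_matrix Z t) \<le> exp (a * t)"
proof -
  have "\<forall>\<^sub>F t in at_top. ereal (1 / t) * (SUP Z\<in>dwell_signals \<Z> \<tau>. log_ext (op_norm (flow_matrix Z t))) < ereal a"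
    using assms unfolding max_lyapunov_def by (rule Limsup_lessD)
  then obtain T0 where T0: "\<And>t. T0 \<le> t \<Longrightarrow>
      ereal (1 / t) * (SUP Z\<in>dwell_signals \<Z> \<tau>. log_ext (op_norm (flow_matrix Z t))) < ereal a"
    unfolding eventually_at_top_linorder by blast
  show ?thesis
  proof (rule that[of "max T0 1"])
    fix t Z assume t: "max T0 1 \<le> t" and Z: "Z \<in> dwell_signals \<Z> \<tau>"
    show "op_norm (flow_matrix Z t) \<le> exp (a * t)"
    proof (cases "op_norm (flow_matrix Z t) = 0")
      case False
      then have pos: "0 < op_norm (flow_matrix Z t)"
        using op_norm_nonneg[of "flow_matrix Z t"] by linarith
      have "log_ext (op_norm (flow_matrix Z t)) \<le> (SUP Z\<in>dwell_signals \<Z> \<tau>. log_ext (op_norm (flow_matrix Z t)))"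
        using Z by (rule SUP_upper)
      then have "ereal (1 / t) * log_ext (op_norm (flow_matrix Z t))
          \<le> ereal (1 / t) * (SUP Z\<in>dwell_signals \<Z> \<tau>. log_ext (op_norm (flow_matrix Z t)))"
        using t by (intro ereal_mult_left_mono) auto
      also have "\<dots> < ereal a" using t by (intro T0) simp
      finally have "1 / t * ln (op_norm (flow_matrix Z t)) < a"
        using False by (simp add: log_ext_def)
      then have "ln (op_norm (flow_matrix Z t)) < a * t" using t by (simp add: field_simps)
      then have "exp (ln (op_norm (flow_matrix Z t))) < exp (a * t)" by simp
      with pos show ?thesis by simp
    qed simp
  qed simp
qed

text \<open>
  The exponent controls only large times, and nothing bounds the number of switchings in a short time when
  \<open>\<tau> = 0\<close>. But a flow at a time before \<open>T\<close> can be continued up to \<open>T\<close> in its last mode, which respects the dwell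
  time, and \<open>e\<^bsup>- (T - t) A\<^esup>\<close> takes it back with a norm of at most \<open>e\<^bsup>M T\<^esup>\<close>.
\<close>

lemma word_bound_of_max_lyapunov_less:
  fixes \<Z> :: "('n::finite) mode set"
  assumes "bounded \<Z>" "0 \<le> \<tau>" and less: "max_lyapunov \<Z> \<tau> < ereal a"
  obtains K where "0 < K" "\<And>l z s x. l \<in> lists (steps \<Z> \<tau>) \<Longrightarrow> z \<in> \<Z> \<Longrightarrow> 0 \<le> s \<Longrightarrow>
    norm (mexp (fst z) s *v fold step_map l x) \<le> K * exp (a * (duration l + s)) * norm x"
proof -
  obtain M where M: "0 \<le> M" "\<And>z. z \<in> \<Z> \<Longrightarrow> op_norm (fst z) \<le> M"
    using bounded_modes_op_norm[OF assms(1)] by metis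
  obtain T where T: "0 < T"
    "\<And>t Z. T \<le> t \<Longrightarrow> Z \<in> dwell_signals \<Z> \<tau> \<Longrightarrow> op_norm (flow_matrix Z t) \<le> exp (a * t)"
    using max_lyapunov_lessD[OF less] by metis
  define K where "K = exp (M * T) * exp (\<bar>a\<bar> * T)"
  have K1: "1 \<le> K" using M(1) T(1) by (simp add: K_def exp_add[symmetric])
  have large: "norm (mexp (fst z) s *v fold step_map l x) \<le> exp (a * (duration l + s)) * norm x"
    if word: "l \<in> lists (steps \<Z> \<tau>)" "z \<in> \<Z>" "0 \<le> s" "T \<le> duration l + s" for l z s x
  proof -
    obtain Z where Z: "Z \<in> dwell_signals \<Z> \<tau>"
      "\<And>x. flow_matrix Z (duration l + s) *v x = mexp (fst z) s *v fold step_map l x"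
      using signal_realizing_word[OF word(1-3) assms(2)] by metis
    have "norm (flow_matrix Z (duration l + s) *v x) \<le> exp (a * (duration l + s)) * norm x"
      using norm_matrix_vector_mult_le T(2)[OF word(4) Z(1)]
      by (rule order_trans[OF _ mult_right_mono]) simp
    then show ?thesis by (simp add: Z(2))
  qed
  show ?thesis
  proof (rule that[of K])
    show "0 < K" using K1 by simp
    fix l z s x
    assume l: "l \<in> lists (steps \<Z> \<tau>)" and z: "z \<in> \<Z>" and s: "(0::real) \<le> s"
    define t where "t = duration l + s"
    have "0 \<le> duration l" using l by (induction l) (auto simp: steps_def)
    then have t0: "0 \<le> t" using s by (simp add: t_def)
    show "norm (mexp (fst z) s *v fold step_map l x) \<le> K * exp (a * (duration l + s)) * norm x"
    proof (cases "T \<le> t")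
      case True
      have "norm (mexp (fst z) s *v fold step_map l x) \<le> 1 * exp (a * t) * norm x"
        using large[OF l z s] True by (simp add: t_def)
      also have "\<dots> \<le> K * exp (a * t) * norm x" using K1 by (intro mult_right_mono) auto
      finally show ?thesis by (simp add: t_def)
    next
      case False
      define s' where "s' = s + (T - t)"
      have s': "0 \<le> s'" "duration l + s' = T" using False s by (simp_all add: s'_def t_def)
      have "mexp (fst z) s *v fold step_map l x
          = mexp (fst z) (- (T - t)) *v (mexp (fst z) s' *v fold step_map l x)"
        by (simp only: matrix_vector_mul_assoc mexp_add[symmetric]) (simp add: s'_def)
      also have "norm \<dots> \<le> exp (M * T) * norm (mexp (fst z) s' *v fold step_map l x)"
        using False t0 M z by (intro norm_mexp_le) auto
      also have "\<dots> \<le> exp (M * T) * (exp (a * T) * norm x)"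
        using large[OF l z s'(1)] s'(2) by (intro mult_left_mono) auto
      also have "exp (a * T) \<le> exp (\<bar>a\<bar> * T) * exp (a * t)"
      proof -
        have "a * (T - t) \<le> \<bar>a\<bar> * T"
          using False t0 T(1) by (intro mult_mono) auto
        then show ?thesis by (simp add: exp_add[symmetric] algebra_simps)
      qed
      finally show ?thesis by (simp add: K_def t_def mult_left_mono mult_right_mono mult.assoc)
    qed
  qed
qed

lemma flow_bound_of_word_bound:
  fixes \<Z> :: "('n::finite) mode set"
  assumes bound: "\<And>l z s x. l \<in> lists (steps \<Z> \<tau>) \<Longrightarrow> z \<in> \<Z> \<Longrightarrow> 0 \<le> s \<Longrightarrow>
      norm (mexp (fst z) s *v fold step_map l x) \<le> K * exp (a * (duration l + s)) * norm x"
    and "Z \<in> dwell_signals \<Z> \<tau>" "0 \<le> t"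
  shows "op_norm (flow_matrix Z t) \<le> K * exp (a * t)"
proof -
  obtain l z s where "l \<in> lists (steps \<Z> \<tau>)" "z \<in> \<Z>" "0 \<le> s" "t = duration l + s"
    "\<And>x. flow_matrix Z t *v x = mexp (fst z) s *v fold step_map l x"
    using flow_matrix_factorization[OF assms(2,3)] by metis
  then show ?thesis using bound by (intro op_norm_le) simp
qed

lemma exp_stable_iff:
  fixes \<Z> :: "('n::finite) mode set"
  assumes "bounded \<Z>" "0 \<le> \<tau>"
  shows "exp_stable \<Z> \<tau> \<longleftrightarrow> max_lyapunov \<Z> \<tau> < 0"
proof
  assume "exp_stable \<Z> \<tau>"
  then obtain c \<delta> where "0 < c" "0 < \<delta>"
    "\<And>t Z. 0 \<le> t \<Longrightarrow> Z \<in> dwell_signals \<Z> \<tau> \<Longrightarrow> op_norm (flow_matrix Z t) \<le> c * exp (- \<delta> * t)"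
    unfolding exp_stable_def by blast
  then have "max_lyapunov \<Z> \<tau> \<le> ereal (- \<delta>)" by (intro max_lyapunov_le)
  also have "\<dots> < 0" using \<open>0 < \<delta>\<close> by simp
  finally show "max_lyapunov \<Z> \<tau> < 0" .
next
  assume "max_lyapunov \<Z> \<tau> < 0"
  then obtain a where a: "max_lyapunov \<Z> \<tau> < ereal a" "ereal a < 0"
    using ereal_dense2 by blast
  obtain K where "0 < K" "\<And>l z s x. l \<in> lists (steps \<Z> \<tau>) \<Longrightarrow> z \<in> \<Z> \<Longrightarrow> 0 \<le> s \<Longrightarrow>
      norm (mexp (fst z) s *v fold step_map l x) \<le> K * exp (a * (duration l + s)) * norm x"
    using word_bound_of_max_lyapunov_less[OF assms a(1)] by metis
  then have "\<forall>t\<ge>0. \<forall>Z\<in>dwell_signals \<Z> \<tau>. op_norm (flow_matrix Z t) \<le> K * exp (- (- a) * t)"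
    using flow_bound_of_word_bound[of \<Z> \<tau> K a] by simp
  moreover have "0 < - a" using a(2) by simp
  ultimately show "exp_stable \<Z> \<tau>"
    unfolding exp_stable_def using \<open>0 < K\<close> by blast
qed

lemma max_lyapunov_pos_of_exp_unstable:
  fixes \<Z> :: "('n::finite) mode set"
  assumes "exp_unstable \<Z> \<tau>"
  shows "0 < max_lyapunov \<Z> \<tau>"
proof -
  obtain c \<delta> Z x where *: "0 < c" "0 < \<delta>" "Z \<in> dwell_signals \<Z> \<tau>" "x \<noteq> 0"
    "\<And>t. 0 \<le> t \<Longrightarrow> c * exp (\<delta> * t) * norm x \<le> norm (flow_matrix Z t *v x)"
    using assms unfolding exp_unstable_def by blast
  have "c * exp (\<delta> * t) \<le> op_norm (flow_matrix Z t)" if "0 \<le> t" for t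
  proof -
    have "c * exp (\<delta> * t) * norm x \<le> op_norm (flow_matrix Z t) * norm x"
      using *(5)[OF that] norm_matrix_vector_mult_le order_trans by blast
    then show ?thesis using \<open>x \<noteq> 0\<close> by simp
  qed
  then have "ereal \<delta> \<le> max_lyapunov \<Z> \<tau>" by (intro max_lyapunov_ge[OF *(1,3)])
  moreover have "0 < ereal \<delta>" using *(2) by simp
  ultimately show ?thesis by (rule less_le_trans[rotated])
qed

section \<open>Instability from a single mode\<close>

lemma uniform_mexp_growth:
  fixes A :: "real^'n^'n"
  assumes "c' < c" "op_norm A \<le> M"
    and "\<And>\<zeta> u. u \<noteq> 0 \<Longrightarrow> map_prod ((*v) A) ((*v) A) u = cscale \<zeta> u \<Longrightarrow> Re \<zeta> \<le> c'" and "0 \<le> t"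
  shows "norm (mexp A t *v x) \<le> (\<Sum>i<DIM((real^'n) \<times> (real^'n)). (2 * M / (c - c')) ^ i) * norm x * exp (c * t)"
proof -
  define f where "f t = (mexp A t *v x, 0 :: real^'n)" for t
  have M: "0 \<le> M" using op_norm_nonneg[of A] assms(2) by linarith
  have "norm (f t) \<le> (\<Sum>i<DIM((real^'n) \<times> (real^'n)). (2 * M / (c - c')) ^ i) * norm (f 0) * exp (c * t)"
  proof (rule linear_ode_growth_on_invariant_subspace[OF assms(1) _ M _ assms(3), where W = UNIV])
    show "linear ((*v) A)" by simp
    show "norm (A *v y) \<le> M * norm y" for y
      by (rule order_trans[OF norm_matrix_vector_mult_le mult_right_mono[OF assms(2)]]) simp
    show "dim (UNIV :: ((real^'n) \<times> (real^'n)) set) \<le> DIM((real^'n) \<times> (real^'n))"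
      by (simp only: dim_UNIV)
    show "(f has_vector_derivative map_prod ((*v) A) ((*v) A) (f t)) (at t)" for t
      unfolding f_def using has_vector_derivative_Pair[OF mexp_has_vector_derivative has_vector_derivative_const]
      by simp
  qed (use assms(4) in auto)
  then show ?thesis by (simp add: f_def)
qed

lemma complex_eigenvector_solution:
  fixes A :: "real^'n^'n"
  assumes "map_prod ((*v) A) ((*v) A) u = cscale \<zeta> u"
  shows "mexp A t *v fst u = fst (cscale (exp (\<zeta> * of_real t)) u)"
proof -
  define e where "e t = exp (\<zeta> * complex_of_real t)" for t
  define y where "y t = fst (cscale (e t) u)" for t
  have e': "(e has_vector_derivative \<zeta> * e s) (at s)" for s
    unfolding e_def by (rule has_vector_derivative_real_field) (auto intro!: derivative_eq_intros)
  have "(y has_vector_derivative A *v y s) (at s)" for s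
  proof -
    have "((\<lambda>s. cscale (e s) u) has_vector_derivative cscale (\<zeta> * e s) u) (at s)"
      using bounded_bilinear.has_vector_derivative[OF bounded_bilinear_cscale e' has_vector_derivative_const]
      by simp
    also have "cscale (\<zeta> * e s) u = cscale (e s) (map_prod ((*v) A) ((*v) A) u)"
      by (simp only: assms cscale_cscale mult.commute)
    also have "\<dots> = map_prod ((*v) A) ((*v) A) (cscale (e s) u)"
      by (simp only: map_prod_cscale matrix_vector_mul_linear)
    finally have "(y has_vector_derivative fst (map_prod ((*v) A) ((*v) A) (cscale (e s) u))) (at s)"
      unfolding y_def by (rule bounded_linear.has_vector_derivative[OF bounded_linear_fst])
    then show ?thesis by (simp add: y_def)
  qed
  then have "y t = mexp A (t - 0) *v y 0"
    by (intro linear_ode_unique[where S = UNIV]) auto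
  then show ?thesis by (simp add: y_def e_def)
qed

text \<open>
  The real part of the complex solution \<open>e\<^bsup>\<zeta> t\<^esup> u\<close> has norm \<open>e\<^bsup>Re \<zeta> t\<^esup>\<close> times a periodic factor. If that factor never
  vanishes, it has a positive minimum. If it vanishes for some phase, that rotation of \<open>u\<close> is purely imaginary;
  then the eigenvalue is real and the imaginary part is a real eigenvector.
\<close>

lemma eigenvector_exponential_orbit:
  fixes A :: "real^'n^'n"
  assumes u: "u \<noteq> 0" "map_prod ((*v) A) ((*v) A) u = cscale \<zeta> u"
  obtains k x where "0 < k" "x \<noteq> 0" "\<And>t. k * exp (Re \<zeta> * t) \<le> norm (mexp A t *v x)"
proof (cases "\<exists>\<theta>. fst (cscale (cis \<theta>) u) = 0")
  case False
  define N where "N = (\<lambda>\<theta>. norm (fst (cscale (cis \<theta>) u)))"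
  have N: "N \<theta> = norm (cos \<theta> *\<^sub>R fst u - sin \<theta> *\<^sub>R snd u)" for \<theta> by (simp add: N_def cscale_def)
  have "continuous_on {0..2 * pi} (\<lambda>\<theta>. norm (cos \<theta> *\<^sub>R fst u - sin \<theta> *\<^sub>R snd u))"
    by (intro continuous_intros)
  then have "\<exists>\<theta>0\<in>{0..2 * pi}. \<forall>\<theta>\<in>{0..2 * pi}. N \<theta>0 \<le> N \<theta>"
    unfolding N by (rule continuous_attains_inf[OF compact_Icc, rotated]) simp
  then obtain \<theta>0 where "\<forall>\<theta>\<in>{0..2 * pi}. N \<theta>0 \<le> N \<theta>" by blast
  then have min: "N \<theta>0 \<le> N \<theta>" if "0 \<le> \<theta>" "\<theta> \<le> 2 * pi" for \<theta>
    using that by simp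
  have N_pos: "0 < N \<theta>0" using False by (simp add: N_def)
  have N_min: "N \<theta>0 \<le> N \<theta>" for \<theta>
  proof -
    have "(cos \<theta>)\<^sup>2 + (sin \<theta>)\<^sup>2 = 1" by simp
    then obtain \<theta>' where "0 \<le> \<theta>'" "\<theta>' < 2 * pi" "cos \<theta> = cos \<theta>'" "sin \<theta> = sin \<theta>'"
      by (rule sincos_total_2pi)
    then show ?thesis using min[of \<theta>'] by (simp add: N)
  qed
  have "fst u \<noteq> 0" using False by (metis cis_zero cscale_one)
  moreover have "N \<theta>0 * exp (Re \<zeta> * t) \<le> norm (mexp A t *v fst u)" for t
  proof -
    have "exp (\<zeta> * of_real t) = of_real (exp (Re \<zeta> * t)) * cis (Im \<zeta> * t)"
      by (simp add: exp_eq_polar)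
    then have "cscale (exp (\<zeta> * of_real t)) u = exp (Re \<zeta> * t) *\<^sub>R cscale (cis (Im \<zeta> * t)) u"
      by (simp only: cscale_cscale[symmetric] cscale_of_real)
    then have "norm (mexp A t *v fst u) = exp (Re \<zeta> * t) * N (Im \<zeta> * t)"
      by (simp add: complex_eigenvector_solution[OF u(2)] N_def)
    then show ?thesis using N_min[of "Im \<zeta> * t"] by (simp add: mult.commute)
  qed
  ultimately show ?thesis using that[of "N \<theta>0" "fst u"] N_pos by blast
next
  case True
  then obtain \<theta> where \<theta>: "fst (cscale (cis \<theta>) u) = 0" ..
  define v where "v = cscale (cis \<theta>) u"
  have "norm v = norm u" by (simp add: v_def norm_cscale)
  then have "v \<noteq> 0" using u(1) by (metis norm_eq_zero)
  have v: "fst v = 0" "snd v \<noteq> 0"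
    using \<theta> \<open>v \<noteq> 0\<close> by (auto simp: v_def[symmetric] prod_eq_iff)
  have ev: "map_prod ((*v) A) ((*v) A) v = cscale \<zeta> v"
    unfolding v_def by (simp only: map_prod_cscale matrix_vector_mul_linear u(2) cscale_cscale mult.commute)
  then have "Im \<zeta> *\<^sub>R snd v = 0" "A *v snd v = Re \<zeta> *\<^sub>R snd v"
    using v by (cases v; simp add: cscale_def)+
  then have im: "Im \<zeta> = 0" and Av: "A *v snd v = Re \<zeta> *\<^sub>R snd v" using v by auto
  have "map_prod ((*v) A) ((*v) A) (snd v, 0) = cscale \<zeta> (snd v, 0)"
    by (simp add: cscale_def Av im)
  from complex_eigenvector_solution[OF this]
  have "mexp A t *v snd v = exp (Re \<zeta> * t) *\<^sub>R snd v" for t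
    by (simp add: cscale_def Re_exp Im_exp im)
  then show ?thesis using that[of "norm (snd v)" "snd v"] v by (simp add: mult.commute)
qed

lemma exp_unstable_of_eigenvalue:
  fixes \<Z> :: "('n::finite) mode set"
  assumes "z \<in> \<Z>" "u \<noteq> 0" "map_prod ((*v) (fst z)) ((*v) (fst z)) u = cscale \<zeta> u" "0 < Re \<zeta>"
  shows "exp_unstable \<Z> \<tau>"
proof -
  obtain Z where Z: "Z \<in> dwell_signals \<Z> \<tau>" "\<And>t x. 0 \<le> t \<Longrightarrow> flow_matrix Z t *v x = mexp (fst z) t *v x"
    using constant_signal[OF assms(1)] by metis
  obtain k x where kx: "0 < k" "x \<noteq> 0" "\<And>t. k * exp (Re \<zeta> * t) \<le> norm (mexp (fst z) t *v x)"
    using eigenvector_exponential_orbit[OF assms(2,3)] by metis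
  have "\<forall>t\<ge>0. (k / norm x) * exp (Re \<zeta> * t) * norm x \<le> norm (flow_matrix Z t *v x)"
    using kx by (simp add: Z(2))
  moreover have "0 < k / norm x" using kx by simp
  ultimately show ?thesis unfolding exp_unstable_def using Z(1) kx(2) assms(4) by blast
qed

section \<open>Instability from expanding words\<close>

text \<open>
  The words of the finite family are concatenated greedily: whenever a word is used up, take one that
  expands the current vector in the seminorm \<open>|p x|\<close>. The invariant along the steps is about the vector that is
  reached when the current word is finished. It yields a lower bound at all intermediate times, because the
  rest of a word from a finite family is bounded by a constant.
\<close>

lemma exp_unstable_of_expanding_words:
  fixes \<Z> :: "('n::finite) mode set" and p :: "real^'n \<Rightarrow> real^'n"
  assumes F: "finite F" "F \<subseteq> lists (steps \<Z> \<tau>)" and p: "linear p" "p x0 \<noteq> 0" and "0 < b" "0 \<le> \<tau>"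
    and expand: "\<And>x. p x \<noteq> 0 \<Longrightarrow> \<exists>l\<in>F. exp (b * duration l) * norm (p x) < norm (p (fold step_map l x))"
  shows "exp_unstable \<Z> \<tau>"
proof -
  define pick where "pick x = (SOME l. l \<in> F \<and> exp (b * duration l) * norm (p x) < norm (p (fold step_map l x)))" for x
  have "pick x \<in> F \<and> exp (b * duration (pick x)) * norm (p x) < norm (p (fold step_map (pick x) x))"
    if "p x \<noteq> 0" for x
    unfolding pick_def by (rule someI_ex) (use expand[OF that] in \<open>simp only: Bex_def\<close>)
  then have pick: "pick x \<in> F" "exp (b * duration (pick x)) * norm (p x) < norm (p (fold step_map (pick x) x))"
    if "p x \<noteq> 0" for x
    using that by simp_all
  have pick_ne: "pick x \<noteq> []" if "p x \<noteq> 0" for x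
    using pick(2)[OF that] by auto
  define E where "E = \<Union> (set ` F)"
  define N where "N = (\<Sum>l\<in>F. length l)"
  have E: "finite E" "E \<subseteq> steps \<Z> \<tau>" "\<And>l. l \<in> F \<Longrightarrow> set l \<subseteq> E"
    using F by (auto simp: E_def)
  have N: "length l \<le> N" if "l \<in> F" for l
    unfolding N_def using member_le_sum[OF that, of length] F(1) by simp
  \<comment> \<open>A state is the current vector with the rest of the current word, which is never empty.\<close>
  define next_state where "next_state = (\<lambda>(x, r). (step_map (hd r) x,
    if tl r = [] then pick (step_map (hd r) x) else tl r))"
  define st where "st k = (next_state ^^ k) (x0, pick x0)" for k
  define X R \<sigma> where "X k = fst (st k)" and "R k = snd (st k)" and "\<sigma> k = hd (R k)" for k
  have X0: "X 0 = x0" "R 0 = pick x0" by (simp_all add: X_def R_def st_def)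
  have XS: "X (Suc k) = step_map (\<sigma> k) (X k)"
    "R (Suc k) = (if tl (R k) = [] then pick (X (Suc k)) else tl (R k))" for k
    by (simp_all add: X_def R_def \<sigma>_def st_def next_state_def case_prod_beta)
  define T where "T k = duration (map \<sigma> [0..<k])" for k
  have T_Suc: "T (Suc k) = T k + snd (\<sigma> k)" "T 0 = 0" for k by (simp_all add: T_def)
  have inv: "R k \<noteq> [] \<and> set (R k) \<subseteq> E \<and> length (R k) \<le> N \<and>
    exp (b * (T k + duration (R k))) * norm (p x0) \<le> norm (p (fold step_map (R k) (X k)))" for k
  proof (induction k)
    case 0
    then show ?case
      using pick[OF p(2)] pick_ne[OF p(2)] E(3) N by (simp add: X0 T_Suc less_imp_le)
  next
    case (Suc k)
    then obtain r where r: "R k = \<sigma> k # r" by (cases "R k") (auto simp: \<sigma>_def)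
    have growth: "exp (b * (T (Suc k) + duration r)) * norm (p x0) \<le> norm (p (fold step_map r (X (Suc k))))"
      using Suc by (simp add: r XS(1) T_Suc algebra_simps)
    show ?case
    proof (cases "r = []")
      case False
      then show ?thesis using Suc growth by (simp add: r XS(2))
    next
      case True
      then have R: "R (Suc k) = pick (X (Suc k))" by (simp add: XS(2) r)
      define y l where "y = X (Suc k)" and "l = pick y"
      have py: "exp (b * T (Suc k)) * norm (p x0) \<le> norm (p y)" using growth True by (simp add: y_def)
      moreover have "0 < exp (b * T (Suc k)) * norm (p x0)" using p(2) by simp
      ultimately have "p y \<noteq> 0" by auto
      note l = pick[OF this, folded l_def] pick_ne[OF this, folded l_def]
      have "exp (b * (T (Suc k) + duration l)) * norm (p x0)
          = exp (b * duration l) * (exp (b * T (Suc k)) * norm (p x0))"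
        by (simp add: exp_add distrib_left)
      also have "\<dots> \<le> exp (b * duration l) * norm (p y)" using py by (intro mult_left_mono) auto
      also have "\<dots> \<le> norm (p (fold step_map l y))" using l(2) by simp
      finally show ?thesis using l E(3) N unfolding R y_def[symmetric] l_def[symmetric] by blast
    qed
  qed
  have X_eq: "X k = fold step_map (map \<sigma> [0..<k]) x0" for k
    by (induction k) (simp_all add: X0 XS)
  have \<sigma>E: "\<sigma> k \<in> E" for k using inv[of k] hd_in_set unfolding \<sigma>_def by blast
  then have \<sigma>: "\<sigma> k \<in> steps \<Z> \<tau>" for k using E(2) by blast
  define \<eta> where "\<eta> = Min (snd ` E)"
  have "E \<noteq> {}" using \<sigma>E by blast
  have \<eta>_le: "\<eta> \<le> snd (\<sigma> k)" for k unfolding \<eta>_def using E(1) \<sigma>E by (intro Min_le) auto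
  have \<eta>_pos: "0 < \<eta>" unfolding \<eta>_def using E(1,2) \<open>E \<noteq> {}\<close> by (subst Min_gr_iff) (auto simp: steps_def)
  \<comment> \<open>\<open>\<rho>\<close> bounds every letter, also after an initial part of its duration has passed\<close>
  define \<rho> where "\<rho> = 1 + (\<Sum>g\<in>E. op_norm (snd (fst g)) * exp (op_norm (fst (fst g)) * snd g))"
  have letter: "norm (snd (fst g) *v (mexp (fst (fst g)) s *v x)) \<le> \<rho> * norm x"
    if "g \<in> E" "0 \<le> s" "s \<le> snd g" for g s x
  proof -
    have "norm (snd (fst g) *v (mexp (fst (fst g)) s *v x)) \<le> op_norm (snd (fst g)) * norm (mexp (fst (fst g)) s *v x)"
      by (rule norm_matrix_vector_mult_le)
    also have "\<dots> \<le> op_norm (snd (fst g)) * (exp (op_norm (fst (fst g)) * snd g) * norm x)"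
      using that by (intro mult_left_mono norm_mexp_le op_norm_nonneg) auto
    also have "\<dots> = op_norm (snd (fst g)) * exp (op_norm (fst (fst g)) * snd g) * norm x" by simp
    also have "\<dots> \<le> \<rho> * norm x"
    proof (rule mult_right_mono)
      show "op_norm (snd (fst g)) * exp (op_norm (fst (fst g)) * snd g) \<le> \<rho>"
        unfolding \<rho>_def
        using member_le_sum[OF that(1), of "\<lambda>g. op_norm (snd (fst g)) * exp (op_norm (fst (fst g)) * snd g)"] E(1)
        by (simp add: op_norm_nonneg)
    qed simp
    finally show ?thesis .
  qed
  have \<rho>: "1 \<le> \<rho>" unfolding \<rho>_def by (simp add: sum_nonneg op_norm_nonneg)
  have word: "norm (fold step_map r x) \<le> \<rho> ^ length r * norm x" if "set r \<subseteq> E" for r x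
    using that
  proof (induction r arbitrary: x)
    case (Cons g r)
    have g: "g \<in> E" "0 \<le> snd g" using Cons.prems E(2) by (auto simp: steps_def)
    have "norm (fold step_map (g # r) x) \<le> \<rho> ^ length r * norm (step_map g x)"
      using Cons by simp
    also have "\<dots> \<le> \<rho> ^ length r * (\<rho> * norm x)"
      unfolding step_map_def using g \<rho> by (intro mult_left_mono letter) auto
    finally show ?case by (simp add: mult.assoc mult.left_commute)
  qed simp
  obtain P where P: "0 < P" "\<And>y. norm (p y) \<le> P * norm y"
    using linear_bounded_pos[OF p(1)] by metis
  define k where "k = norm (p x0) / (P * \<rho> ^ N * \<rho> * norm x0)"
  have "x0 \<noteq> 0" using p by (auto simp: linear_0)
  then have k: "0 < k" using p(2) P(1) \<rho> by (simp add: k_def)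
  show ?thesis
  proof (rule signal_of_steps[of \<sigma> \<Z> \<tau> \<eta>, OF \<sigma> \<eta>_pos \<eta>_le \<open>0 \<le> \<tau>\<close>])
    fix Z
    assume Z: "Z \<in> dwell_signals \<Z> \<tau>"
      and flow: "\<And>k s x. 0 \<le> s \<Longrightarrow> s < snd (\<sigma> k) \<Longrightarrow>
        flow_matrix Z (duration (map \<sigma> [0..<k]) + s) *v x =
        mexp (fst (fst (\<sigma> k))) s *v fold step_map (map \<sigma> [0..<k]) x"
      and cover: "\<And>t. 0 \<le> t \<Longrightarrow> \<exists>k s. 0 \<le> s \<and> s < snd (\<sigma> k) \<and> t = duration (map \<sigma> [0..<k]) + s"
    have "k * exp (b * t) * norm x0 \<le> norm (flow_matrix Z t *v x0)" if t: "0 \<le> t" for t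
    proof -
      obtain j s where js: "0 \<le> s" "s < snd (\<sigma> j)" "t = T j + s"
        using cover[OF t] unfolding T_def by blast
      define A where "A = fst (fst (\<sigma> j))"
      define y where "y = mexp A s *v X j"
      have y: "flow_matrix Z t *v x0 = y"
        using flow[OF js(1,2)] by (simp add: y_def A_def X_eq js(3) T_def)
      obtain r where r: "R j = \<sigma> j # r" using inv[of j] by (cases "R j") (auto simp: \<sigma>_def)
      have rE: "set r \<subseteq> E" "length r \<le> N" using inv[of j] by (auto simp: r)
      have "0 \<le> duration r" using rE(1) E(2) by (induction r) (auto simp: steps_def)
      have "mexp A (snd (\<sigma> j)) *v X j = mexp A (snd (\<sigma> j) - s) *v y"
        unfolding y_def by (simp only: matrix_vector_mul_assoc mexp_add[symmetric]) simp
      then have step: "step_map (\<sigma> j) (X j) = snd (fst (\<sigma> j)) *v (mexp A (snd (\<sigma> j) - s) *v y)"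
        by (simp add: step_map_def A_def)
      have "exp (b * t) * norm (p x0) \<le> exp (b * (T j + duration (R j))) * norm (p x0)"
        using js \<open>0 \<le> duration r\<close> \<open>0 < b\<close> by (intro mult_right_mono) (auto simp: r)
      also have "\<dots> \<le> norm (p (fold step_map r (step_map (\<sigma> j) (X j))))"
        using inv[of j] by (simp add: r)
      also have "\<dots> \<le> P * norm (fold step_map r (step_map (\<sigma> j) (X j)))" by (rule P(2))
      also have "\<dots> \<le> P * (\<rho> ^ length r * norm (step_map (\<sigma> j) (X j)))"
        using P(1) word[OF rE(1)] by (intro mult_left_mono) auto
      also have "\<dots> \<le> P * (\<rho> ^ N * (\<rho> * norm y))"
        unfolding step A_def using \<rho> P(1) rE(2) js(1,2)
        by (intro mult_left_mono mult_mono power_increasing letter \<sigma>E) auto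
      finally have "exp (b * t) * norm (p x0) \<le> (P * \<rho> ^ N * \<rho>) * norm y" by (simp add: mult.assoc)
      moreover have "k * exp (b * t) * norm x0 = exp (b * t) * norm (p x0) / (P * \<rho> ^ N * \<rho>)"
        using \<open>x0 \<noteq> 0\<close> by (simp add: k_def)
      moreover have "0 < P * \<rho> ^ N * \<rho>" using P(1) \<rho> by simp
      ultimately show ?thesis by (simp add: y pos_divide_le_eq mult.commute)
    qed
    with Z k \<open>0 < b\<close> \<open>x0 \<noteq> 0\<close> show ?thesis unfolding exp_unstable_def by blast
  qed
qed

text \<open>
  Durations below one carry no bound on the number of letters, and single letters can be long. Cutting a word as
  soon as it reaches duration one gives pieces that consist of a short word and one letter: the first is bounded
  uniformly, the second by the growth inside a mode.
\<close>

definition chunks :: "('n::finite) mode set \<Rightarrow> real \<Rightarrow> 'n step list set" where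
  "chunks \<Z> \<tau> = {l @ [g] | l g. l \<in> lists (steps \<Z> \<tau>) \<and> g \<in> steps \<Z> \<tau> \<and>
    duration l < 1 \<and> 1 \<le> duration (l @ [g])}"

lemma chunk_decomposition:
  fixes \<Z> :: "('n::finite) mode set"
  assumes "l \<in> lists (steps \<Z> \<tau>)"
  obtains L e where "L \<in> lists (chunks \<Z> \<tau>)" "e \<in> lists (steps \<Z> \<tau>)" "duration e < 1" "l = concat L @ e"
proof -
  have "\<exists>L e. L \<in> lists (chunks \<Z> \<tau>) \<and> e \<in> lists (steps \<Z> \<tau>) \<and> duration e < 1 \<and> l = concat L @ e"
    using assms
  proof (induction l rule: rev_induct)
    case Nil
    show ?case by (intro exI[of _ "[]"]) simp
  next
    case (snoc g l)
    then have g: "g \<in> steps \<Z> \<tau>" by simp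
    obtain L e where Le: "L \<in> lists (chunks \<Z> \<tau>)" "e \<in> lists (steps \<Z> \<tau>)" "duration e < 1" "l = concat L @ e"
      using snoc by auto
    show ?case
    proof (cases "duration (e @ [g]) < 1")
      case True
      then show ?thesis using Le g by (intro exI[of _ L] exI[of _ "e @ [g]"]) simp
    next
      case False
      then have "e @ [g] \<in> chunks \<Z> \<tau>"
        unfolding chunks_def using Le g by (intro CollectI exI[of _ e] exI[of _ g] conjI refl) simp_all
      then show ?thesis using Le by (intro exI[of _ "L @ [e @ [g]]"] exI[of _ "[]"]) simp
    qed
  qed
  then show ?thesis using that by blast
qed

text \<open>
  The thresholds are \<open>c / 2 = a / 4\<close> for the eigenvalues, \<open>c = a / 2\<close> for the growth inside a mode and of a chunk,
  and \<open>a' = 3 a / 4\<close> for the growth of words. If concatenated chunks were bounded at rate \<open>a'\<close>, then all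
  flows would be as well, since the unfinished pieces of a flow cost at most a constant and the rate \<open>c < a'\<close>.
  That contradicts \<open>a' < a < \<lambda>\<close>.
\<close>

lemma exp_unstable_of_max_lyapunov_pos:
  fixes \<Z> :: "('n::finite) mode set"
  assumes bdd: "bounded \<Z>" and \<tau>: "0 \<le> \<tau>" and fin: "max_lyapunov \<Z> \<tau> < \<infinity>" and pos: "0 < max_lyapunov \<Z> \<tau>"
  shows "exp_unstable \<Z> \<tau>"
proof -
  obtain a where a: "0 < a" "ereal a < max_lyapunov \<Z> \<tau>"
    using ereal_dense2[OF pos] by auto
  define c where "c = a / 2"
  show ?thesis
  proof (cases "\<exists>z\<in>\<Z>. \<exists>\<zeta> u. u \<noteq> 0 \<and> map_prod ((*v) (fst z)) ((*v) (fst z)) u = cscale \<zeta> u \<and> c / 2 < Re \<zeta>")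
    case True
    then obtain z \<zeta> u where "z \<in> \<Z>" "u \<noteq> 0" "map_prod ((*v) (fst z)) ((*v) (fst z)) u = cscale \<zeta> u"
      "c / 2 < Re \<zeta>" by blast
    moreover from this a(1) have "0 < Re \<zeta>" by (simp add: c_def)
    ultimately show ?thesis by (intro exp_unstable_of_eigenvalue)
  next
    case False
    then have ev: "\<And>z \<zeta> u. z \<in> \<Z> \<Longrightarrow> u \<noteq> 0 \<Longrightarrow> map_prod ((*v) (fst z)) ((*v) (fst z)) u = cscale \<zeta> u \<Longrightarrow> Re \<zeta> \<le> c / 2"
      by (meson not_less)
    obtain M where M: "0 \<le> M" "\<And>z. z \<in> \<Z> \<Longrightarrow> op_norm (fst z) \<le> M" "\<And>z. z \<in> \<Z> \<Longrightarrow> op_norm (snd z) \<le> M"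
      using bounded_modes_op_norm[OF bdd] by metis
    have cpos: "c / 2 < c" using a(1) by (simp add: c_def)
    define K1 where "K1 = (\<Sum>i<DIM((real^'n) \<times> (real^'n)). (2 * M / (c - c / 2)) ^ i)"
    have K1: "norm (mexp (fst z) t *v x) \<le> K1 * exp (c * t) * norm x" if z: "z \<in> \<Z>" and t: "0 \<le> t" for z t x
    proof -
      have "norm (mexp (fst z) t *v x) \<le> K1 * norm x * exp (c * t)"
        unfolding K1_def
        by (rule uniform_mexp_growth[OF cpos M(2)[OF z]]) (rule ev[OF z], assumption, assumption, rule t)
      then show ?thesis by (simp only: ac_simps)
    qed
    have K1_nonneg: "0 \<le> K1" unfolding K1_def using M(1) cpos by (intro sum_nonneg) auto
    obtain \<beta> where \<beta>: "max_lyapunov \<Z> \<tau> < ereal \<beta>" using ereal_dense2[OF fin] by blast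
    then have "0 < ereal \<beta>" using pos by (rule less_trans[rotated])
    then have \<beta>_pos: "0 < \<beta>" by simp
    obtain K2 where K2: "0 < K2" "\<And>l z s x. l \<in> lists (steps \<Z> \<tau>) \<Longrightarrow> z \<in> \<Z> \<Longrightarrow> 0 \<le> s \<Longrightarrow>
        norm (mexp (fst z) s *v fold step_map l x) \<le> K2 * exp (\<beta> * (duration l + s)) * norm x"
      using word_bound_of_max_lyapunov_less[OF bdd \<tau> \<beta>] by metis
    \<comment> \<open>\<open>K3\<close> bounds all words of duration below one; the finiteness of the exponent enters here, through \<open>K2\<close>\<close>
    define K3 where "K3 = K2 * exp \<beta>"
    have K3: "norm (fold step_map e x) \<le> K3 * norm x" if e: "e \<in> lists (steps \<Z> \<tau>)" "duration e < 1" "\<Z> \<noteq> {}" for e x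
    proof -
      obtain z where z: "z \<in> \<Z>" using e(3) by blast
      have "norm (fold step_map e x) \<le> K2 * exp (\<beta> * duration e) * norm x"
        using K2(2)[OF e(1) z order_refl, of x] by simp
      also have "\<dots> \<le> K2 * exp (\<beta> * 1) * norm x"
        using e(2) K2(1) \<beta>_pos by (intro mult_right_mono mult_left_mono) auto
      finally show ?thesis by (simp add: K3_def)
    qed
    define K where "K = M * K1 * K3"
    have K3_nonneg: "0 \<le> K3" using K2(1) by (simp add: K3_def)
    define G where "G = {l \<in> lists (steps \<Z> \<tau>). 1 \<le> duration l \<and>
      (\<forall>x. norm (fold step_map l x) \<le> K * exp (c * duration l) * norm x)}"
    have "0 \<le> K" using M(1) K1_nonneg K3_nonneg by (simp add: K_def)
    then interpret timed_generators G "fold step_map" duration K c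
      by (intro timed_generators.intro) (simp_all add: G_def linear_fold_step_map)
    have chunk: "q \<in> G" if chunk: "q \<in> chunks \<Z> \<tau>" for q
    proof -
      obtain e g where q: "q = e @ [g]" and e: "e \<in> lists (steps \<Z> \<tau>)" "duration e < 1"
        and g: "g \<in> steps \<Z> \<tau>" and ge: "1 \<le> duration (e @ [g])"
        using chunk unfolding chunks_def by blast
      have z: "fst g \<in> \<Z>" "0 \<le> snd g" using g by (auto simp: steps_def)
      have e0: "0 \<le> duration e" using e(1) by (induction e) (auto simp: steps_def)
      have "norm (fold step_map (e @ [g]) x) \<le> K * exp (c * duration (e @ [g])) * norm x" for x
      proof -
        have "norm (fold step_map (e @ [g]) x) \<le> op_norm (snd (fst g)) * norm (mexp (fst (fst g)) (snd g) *v fold step_map e x)"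
          by (simp add: step_map_def norm_matrix_vector_mult_le)
        also have "\<dots> \<le> M * norm (mexp (fst (fst g)) (snd g) *v fold step_map e x)"
          using M(3)[OF z(1)] by (intro mult_right_mono) auto
        also have "\<dots> \<le> M * (K1 * exp (c * snd g) * norm (fold step_map e x))"
          using M(1) K1[OF z] by (intro mult_left_mono) auto
        also have "\<dots> \<le> M * (K1 * exp (c * duration (e @ [g])) * (K3 * norm x))"
          using M(1) K1_nonneg e0 a(1) K3[OF e] z(1)
          by (intro mult_left_mono mult_mono) (auto simp: c_def)
        also have "\<dots> = K * exp (c * duration (e @ [g])) * norm x"
          by (simp only: K_def ac_simps)
        finally show ?thesis .
      qed
      then show ?thesis unfolding q G_def using e g ge by simp
    qed
    have fold_concat: "fold (fold step_map) L x = fold step_map (concat L) x" for L and x :: "real^'n"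
      by (induction L arbitrary: x) simp_all
    have dur_concat: "dur L = duration (concat L)" for L
      by (induction L) simp_all
    have concat_steps: "concat L \<in> lists (steps \<Z> \<tau>)" if "L \<in> lists G" for L
      using that
    proof (induction L)
      case (Cons q L)
      then have "q \<in> lists (steps \<Z> \<tau>)" unfolding G_def by blast
      with Cons.IH show ?case by simp
    qed simp
    define a' where "a' = 3 * a / 4"
    have a': "c < a'" "a' < a" using a(1) by (simp_all add: a'_def c_def)
    have unbounded: "\<not> (\<exists>C. \<forall>L\<in>lists G. \<forall>x. norm (fold (fold step_map) L x) \<le> C * norm x * exp (a' * dur L))"
    proof
      assume "\<exists>C. \<forall>L\<in>lists G. \<forall>x. norm (fold (fold step_map) L x) \<le> C * norm x * exp (a' * dur L)"
      then obtain C where C: "\<And>L x. L \<in> lists G \<Longrightarrow> norm (fold (fold step_map) L x) \<le> C * norm x * exp (a' * dur L)"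
        by blast
      define C' where "C' = K1 * K3 * \<bar>C\<bar> + 1"
      have C': "0 < C'" unfolding C'_def using K1_nonneg K3_nonneg by (intro add_nonneg_pos) auto
      have "norm (mexp (fst z) s *v fold step_map l x) \<le> C' * exp (a' * (duration l + s)) * norm x"
        if l: "l \<in> lists (steps \<Z> \<tau>)" and z: "z \<in> \<Z>" and s: "0 \<le> s" for l z s x
      proof -
        obtain L e where L: "L \<in> lists (chunks \<Z> \<tau>)"
          and Le: "l = concat L @ e" "e \<in> lists (steps \<Z> \<tau>)" "duration e < 1"
          using chunk_decomposition[OF l] by metis
        have LG: "L \<in> lists G" using L chunk by blast
        have e0: "0 \<le> duration e" using Le(2) by (induction e) (auto simp: steps_def)
        define y where "y = fold step_map (concat L) x"
        have y: "norm y \<le> \<bar>C\<bar> * (norm x * exp (a' * duration (concat L)))"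
        proof -
          have "norm y \<le> C * (norm x * exp (a' * duration (concat L)))"
            using C[OF LG, of x] by (simp add: y_def fold_concat dur_concat mult.assoc)
          also have "\<dots> \<le> \<bar>C\<bar> * (norm x * exp (a' * duration (concat L)))"
            by (intro mult_right_mono) auto
          finally show ?thesis .
        qed
        have "norm (mexp (fst z) s *v fold step_map l x) \<le> K1 * exp (c * s) * norm (fold step_map e y)"
          using K1[OF z s] by (simp add: Le(1) y_def)
        also have "\<dots> \<le> K1 * exp (a' * (duration e + s)) * (K3 * norm y)"
        proof (intro mult_mono mult_left_mono)
          show "norm (fold step_map e y) \<le> K3 * norm y" using K3[OF Le(2,3)] z by blast
          have "c * s \<le> a' * (duration e + s)"
            using a' s e0 a(1) by (intro mult_mono) (auto simp: a'_def)
          then show "exp (c * s) \<le> exp (a' * (duration e + s))" by simp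
        qed (use K1_nonneg in auto)
        also have "\<dots> \<le> K1 * exp (a' * (duration e + s)) * (K3 * (\<bar>C\<bar> * (norm x * exp (a' * duration (concat L)))))"
          using K1_nonneg K3_nonneg y by (intro mult_left_mono) auto
        also have "\<dots> = K1 * K3 * \<bar>C\<bar> * (exp (a' * (duration l + s)) * norm x)"
          by (simp add: Le(1) distrib_left exp_add)
        also have "\<dots> \<le> C' * (exp (a' * (duration l + s)) * norm x)"
          by (intro mult_right_mono) (auto simp: C'_def)
        finally show ?thesis by simp
      qed
      then have "op_norm (flow_matrix Z t) \<le> C' * exp (a' * t)" if "0 \<le> t" "Z \<in> dwell_signals \<Z> \<tau>" for t Z
        using that by (intro flow_bound_of_word_bound)
      then have "max_lyapunov \<Z> \<tau> \<le> ereal a'" by (intro max_lyapunov_le[OF C'])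
      also have "\<dots> < ereal a" using a' by simp
      finally show False using a(2) by simp
    qed
    show ?thesis
    proof (rule finitely_many_expanding_words[OF a'(1) unbounded])
      fix p :: "real^'n \<Rightarrow> real^'n" and b F
      assume p: "linear p" "\<exists>x. p x \<noteq> 0" and b: "c < b" and F: "finite F" "F \<subseteq> lists G"
        and expand: "\<And>x. p x \<noteq> 0 \<Longrightarrow>
          \<exists>l\<in>F. exp (b * dur l) * norm (p x) < norm (p (fold (fold step_map) l x))"
      obtain x0 where x0: "p x0 \<noteq> 0" using p(2) by blast
      show ?thesis
      proof (rule exp_unstable_of_expanding_words[of "concat ` F" \<Z> \<tau> p x0 b])
        show "concat ` F \<subseteq> lists (steps \<Z> \<tau>)" using F(2) concat_steps by blast
        show "0 < b" using b a(1) by (simp add: c_def)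
        show "\<exists>l\<in>concat ` F. exp (b * duration l) * norm (p x) < norm (p (fold step_map l x))"
          if "p x \<noteq> 0" for x
          using expand[OF that] by (simp add: fold_concat dur_concat)
      qed (use F(1) p(1) x0 \<tau> in auto)
    qed
  qed
qed

section \<open>Exponential stability and instability\<close>

theorem corollary1:
  fixes \<Z> :: "('n::finite) mode set" and \<tau> :: real
  assumes "bounded \<Z>" and "\<tau> \<ge> 0" and "max_lyapunov \<Z> \<tau> < \<infinity>"
  shows "(exp_stable \<Z> \<tau> \<longleftrightarrow> max_lyapunov \<Z> \<tau> < 0) \<and>
         (exp_unstable \<Z> \<tau> \<longleftrightarrow> max_lyapunov \<Z> \<tau> > 0)"
  using exp_stable_iff[OF assms(1,2)] exp_unstable_of_max_lyapunov_pos[OF assms]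
    max_lyapunov_pos_of_exp_unstable by blast

end
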